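(* Let $\mathsf V$ be the variety of all $\ell$-groups (respectively, the variety of representable $\ell$-groups, or the variety of Abelian $\ell$-groups). For any partially ordered group $G$, the minimal layer of $\mathscr{P}_{\mathsf V}(G)$, i.e. the subspace of its inclusion-minimal elements, is homeomorphic to the space $\mathscr{R}(\eta[G])$ of right orders (respectively, in both the representable and the Abelian case, to the space $\mathscr{O}(\eta[G])$ of orders) on the partially ordered group $\eta[G]$, where $\eta\colon G\to F_{\mathsf V}(G)$ is the universal map.
   Context: A partially ordered group is a group $G$ (identity $\mathrm{e}$) with a partial order such that $a\le b$ implies $sat\le sbt$; $G^+=\{a\mid a\ge \mathrm{e}\}$. An $\ell$-group is a partially ordered group whose order is a lattice; it is representable if it is a subdirect product of totally ordered groups, and Abelian if its group is Abelian. An $\ell$-subgroup is a sublattice subgroup; an $\ell$-homomorphism is a group and lattice homomorphism; a positive homomorphism is an order-preserving group homomorphism. A right pre-order on $G$ is a reflexive, transitive, total relation $\preceq$ on $G$, with $\preceq\ne G\times G$, extending the partial order of $G$ and such that $a\preceq b\Rightarrow at\preceq bt$. It is identified with its pre-cone $C=\{a\mid \mathrm{e}\preceq a\}$; pre-cones are exactly the proper submonoids $C\subsetneq G$ with $G=C\cup C^{-1}$ and $G^+\subseteq C$, and $a\preceq_C b$ iff $ba^{-1}\in C$. Put $a\equiv_C b$ iff $a\preceq_C b$ and $b\preceq_C a$; $\Omega_C=G/{\equiv_C}$ is a chain with $[a]\le_C[b]$ iff $a\preceq_C b$. $\mathrm{Aut}\,\Omega_C$ is the $\ell$-group of order-preserving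 bijections of $\Omega_C$, where $f\cdot g$ means "$g$ after $f$" and lattice operations are pointwise. With $R_C(a)\colon[b]\mapsto[ba]$, $H_C$ is the $\ell$-subgroup of $\mathrm{Aut}\,\Omega_C$ generated by $R_C[G]$. $\mathscr{P}_{\mathsf V}(G)$ is the set of right pre-orders (pre-cones) $C$ on $G$ with $H_C\in\mathsf V$, ordered by inclusion, with the smallest topology containing all sets $\mathbb{P}(a)=\{C\in\mathscr{P}_{\mathsf V}(G)\mid a\in C,\ a^{-1}\notin C\}$, $a\in G$. $F_{\mathsf V}(G)$, with positive homomorphism $\eta\colon G\to F_{\mathsf V}(G)$, is the free $\ell$-group over $G$ in $\mathsf V$: $F_{\mathsf V}(G)\in\mathsf V$ and for each positive homomorphism $p\colon G\to H$ with $H\in\mathsf V$ there is exactly one $\ell$-homomorphism $h$ with $h\circ\eta=p$. The group image $\eta[G]$ is partially ordered by the restriction of the order of $F_{\mathsf V}(G)$. For a partially ordered group $K$, a right order on $K$ is a right-invariant total order on $K$ extending the partial order of $K$ and different from $K\times K$ (so a trivial group has none); equivalently, a pre-cone $C$ of $K$ with $C\cap C^{-1}=\{\mathrm{e}\}$. An order is a right order that is also left invariant (equivalently, with $C$ normal). $\mathscr{R}(K)$ is the set of right orders with the topology having as subbase the sets $\{C\in\mathscr R(K)\mid a\in C\}$ and $\{C\in\mathscr R(K)\mid a\notin C\}$, $a\in K$; $\mathscr{O}(K)\subseteq\mathscr R(K)$ is the subspace of orders. *)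

theory Defs
  imports "HOL-Analysis.Abstract_Topology" "HOL-Algebra.Bij" "HOL-Algebra.Product_Groups"
    "HOL-Algebra.Lattice"
begin

section \<open>Partially ordered groups and lattice-ordered groups\<close>

record 'a pogroup = "'a monoid" +
  ple :: "'a \<Rightarrow> 'a \<Rightarrow> bool" (infixl \<open>\<preceq>\<index>\<close> 50)

text \<open>The underlying ordered set, as an object of the order theory of HOL-Algebra.\<close>

definition order_of :: "'a pogroup \<Rightarrow> 'a gorder" where
  "order_of G = \<lparr>carrier = carrier G, eq = (=), le = ple G\<rparr>"

definition po_group :: "'a pogroup \<Rightarrow> bool" where
  "po_group G \<longleftrightarrow> group G \<and> partial_order (order_of G) \<and>
     (\<forall>a\<in>carrier G. \<forall>b\<in>carrier G. \<forall>s\<in>carrier G. \<forall>t\<in>carrier G.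
        a \<preceq>\<^bsub>G\<^esub> b \<longrightarrow> s \<otimes>\<^bsub>G\<^esub> a \<otimes>\<^bsub>G\<^esub> t \<preceq>\<^bsub>G\<^esub> s \<otimes>\<^bsub>G\<^esub> b \<otimes>\<^bsub>G\<^esub> t)"

definition l_group :: "'a pogroup \<Rightarrow> bool" where
  "l_group G \<longleftrightarrow> po_group G \<and> lattice (order_of G)"

definition to_group :: "'a pogroup \<Rightarrow> bool" where
  "to_group G \<longleftrightarrow> po_group G \<and> total_order (order_of G)"

definition pos_hom :: "'a pogroup \<Rightarrow> 'b pogroup \<Rightarrow> ('a \<Rightarrow> 'b) set" where
  "pos_hom G H = {h \<in> hom G H.
     \<forall>a\<in>carrier G. \<forall>b\<in>carrier G. a \<preceq>\<^bsub>G\<^esub> b \<longrightarrow> h a \<preceq>\<^bsub>H\<^esub> h b}"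

definition l_hom :: "'a pogroup \<Rightarrow> 'b pogroup \<Rightarrow> ('a \<Rightarrow> 'b) set" where
  "l_hom G H = {h \<in> hom G H.
     \<forall>a\<in>carrier G. \<forall>b\<in>carrier G.
       h (a \<squnion>\<^bsub>order_of G\<^esub> b) = h a \<squnion>\<^bsub>order_of H\<^esub> h b \<and>
       h (a \<sqinter>\<^bsub>order_of G\<^esub> b) = h a \<sqinter>\<^bsub>order_of H\<^esub> h b}"

definition l_subgroup :: "'a set \<Rightarrow> 'a pogroup \<Rightarrow> bool" where
  "l_subgroup S G \<longleftrightarrow> subgroup S G \<and>
     (\<forall>a\<in>S. \<forall>b\<in>S. a \<squnion>\<^bsub>order_of G\<^esub> b \<in> S \<and> a \<sqinter>\<^bsub>order_of G\<^esub> b \<in> S)"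

definition l_generate :: "'a pogroup \<Rightarrow> 'a set \<Rightarrow> 'a set" where
  "l_generate G X = \<Inter>{S. l_subgroup S G \<and> X \<subseteq> S}"

definition l_product :: "'i set \<Rightarrow> ('i \<Rightarrow> 'a pogroup) \<Rightarrow> ('i \<Rightarrow> 'a) pogroup" where
  "l_product I T =
     \<lparr>carrier = carrier (product_group I T),
      monoid.mult = monoid.mult (product_group I T),
      one = one (product_group I T),
      ple = (\<lambda>x y. \<forall>i\<in>I. x i \<preceq>\<^bsub>T i\<^esub> y i)\<rparr>"

text \<open>In a subdirect representation each factor is isomorphic to a quotient of \<open>G\<close>, which lives
  on the cosets of its kernel, and a factor with the same kernel as another one can be omitted.
  Hence nothing is lost by letting sets of elements of \<open>G\<close> serve both as indices and as elements
  of the factors.\<close>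

definition representable :: "'a pogroup \<Rightarrow> bool" where
  "representable G \<longleftrightarrow> l_group G \<and>
     (\<exists>(I :: 'a set set) (T :: 'a set \<Rightarrow> 'a set pogroup) \<phi>.
        (\<forall>i\<in>I. to_group (T i)) \<and>
        \<phi> \<in> l_hom G (l_product I T) \<and> inj_on \<phi> (carrier G) \<and>
        (\<forall>i\<in>I. (\<lambda>x. \<phi> x i) ` carrier G = carrier (T i)))"

datatype variety = All | Representable | Abelian

fun in_variety :: "variety \<Rightarrow> 'a pogroup \<Rightarrow> bool" where
  "in_variety All G \<longleftrightarrow> l_group G"
| "in_variety Representable G \<longleftrightarrow> representable G"
| "in_variety Abelian G \<longleftrightarrow> l_group G \<and> comm_group G"

section \<open>Right pre-orders and pre-cones\<close>

definition right_preorder :: "'a pogroup \<Rightarrow> 'a rel \<Rightarrow> bool" where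
  "right_preorder G r \<longleftrightarrow>
     preorder_on (carrier G) r \<and> total_on (carrier G) r \<and> r \<noteq> carrier G \<times> carrier G \<and>
     (\<forall>a\<in>carrier G. \<forall>b\<in>carrier G. a \<preceq>\<^bsub>G\<^esub> b \<longrightarrow> (a, b) \<in> r) \<and>
     (\<forall>a b. \<forall>t\<in>carrier G. (a, b) \<in> r \<longrightarrow> (a \<otimes>\<^bsub>G\<^esub> t, b \<otimes>\<^bsub>G\<^esub> t) \<in> r)"

definition cone_of :: "'a pogroup \<Rightarrow> 'a rel \<Rightarrow> 'a set" where
  "cone_of G r = {a \<in> carrier G. (\<one>\<^bsub>G\<^esub>, a) \<in> r}"

definition precones :: "'a pogroup \<Rightarrow> 'a set set" where
  "precones G = cone_of G ` {r. right_preorder G r}"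

definition precone_rel :: "'a pogroup \<Rightarrow> 'a set \<Rightarrow> 'a rel" where
  "precone_rel G C = {(a, b). a \<in> carrier G \<and> b \<in> carrier G \<and> b \<otimes>\<^bsub>G\<^esub> inv\<^bsub>G\<^esub> a \<in> C}"

lemma precone_rel_cone_of:
  assumes "po_group G" "right_preorder G r"
  shows "precone_rel G (cone_of G r) = r"
proof -
  interpret group G using assms(1) by (simp add: po_group_def)
  have sub: "r \<subseteq> carrier G \<times> carrier G"
    and inv: "\<And>a b t. (a, b) \<in> r \<Longrightarrow> t \<in> carrier G \<Longrightarrow> (a \<otimes>\<^bsub>G\<^esub> t, b \<otimes>\<^bsub>G\<^esub> t) \<in> r"
    using assms(2) by (auto simp: right_preorder_def preorder_on_def)
  have "(\<one>\<^bsub>G\<^esub>, b \<otimes>\<^bsub>G\<^esub> inv\<^bsub>G\<^esub> a) \<in> r \<longleftrightarrow> (a, b) \<in> r"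
    if "a \<in> carrier G" "b \<in> carrier G" for a b
    using inv[of "\<one>\<^bsub>G\<^esub>" "b \<otimes>\<^bsub>G\<^esub> inv\<^bsub>G\<^esub> a" a] inv[of a b "inv\<^bsub>G\<^esub> a"] that by (auto simp: m_assoc)
  then show ?thesis
    using sub by (auto simp: precone_rel_def cone_of_def)
qed

section \<open>The lattice-ordered group of a pre-cone\<close>

definition precone_equiv :: "'a pogroup \<Rightarrow> 'a set \<Rightarrow> 'a rel" where
  "precone_equiv G C = precone_rel G C \<inter> (precone_rel G C)\<inverse>"

definition Omega :: "'a pogroup \<Rightarrow> 'a set \<Rightarrow> 'a set gorder" where
  "Omega G C =
     \<lparr>carrier = carrier G // precone_equiv G C, eq = (=),
      le = (\<lambda>X Y. \<exists>a\<in>X. \<exists>b\<in>Y. (a, b) \<in> precone_rel G C)\<rparr>"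

text \<open>Maps act on the right: the product of \<open>f\<close> and \<open>g\<close> is \<open>g\<close> after \<open>f\<close>. The lattice operations
  are those of the pointwise order, which on a chain are the pointwise ones.\<close>

definition Aut_chain :: "'b gorder \<Rightarrow> ('b \<Rightarrow> 'b) pogroup" where
  "Aut_chain L =
     \<lparr>carrier = {f \<in> Bij (carrier L).
        \<forall>x\<in>carrier L. \<forall>y\<in>carrier L. x \<sqsubseteq>\<^bsub>L\<^esub> y \<longrightarrow> f x \<sqsubseteq>\<^bsub>L\<^esub> f y},
      monoid.mult = (\<lambda>f g. compose (carrier L) g f),
      one = (\<lambda>x\<in>carrier L. x),
      ple = (\<lambda>f g. \<forall>x\<in>carrier L. f x \<sqsubseteq>\<^bsub>L\<^esub> g x)\<rparr>"

definition R_map :: "'a pogroup \<Rightarrow> 'a set \<Rightarrow> 'a \<Rightarrow> 'a set \<Rightarrow> 'a set" where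
  "R_map G C a =
     (\<lambda>X\<in>carrier (Omega G C). \<Union>b\<in>X. precone_equiv G C `` {b \<otimes>\<^bsub>G\<^esub> a})"

definition H_grp :: "'a pogroup \<Rightarrow> 'a set \<Rightarrow> ('a set \<Rightarrow> 'a set) pogroup" where
  "H_grp G C = (Aut_chain (Omega G C))
     \<lparr>carrier := l_generate (Aut_chain (Omega G C)) (R_map G C ` carrier G)\<rparr>"

section \<open>The space of right pre-orders and its minimal layer\<close>

definition P_set :: "variety \<Rightarrow> 'a pogroup \<Rightarrow> 'a set set" where
  "P_set V G = {C \<in> precones G. in_variety V (H_grp G C)}"

definition P_basic :: "variety \<Rightarrow> 'a pogroup \<Rightarrow> 'a \<Rightarrow> 'a set set" where
  "P_basic V G a = {C \<in> P_set V G. a \<in> C \<and> inv\<^bsub>G\<^esub> a \<notin> C}"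

definition P_space :: "variety \<Rightarrow> 'a pogroup \<Rightarrow> 'a set topology" where
  "P_space V G = topology_generated_by (insert (P_set V G) (P_basic V G ` carrier G))"

definition minimal_layer :: "variety \<Rightarrow> 'a pogroup \<Rightarrow> 'a set topology" where
  "minimal_layer V G = subtopology (P_space V G)
     {C \<in> P_set V G. \<forall>D\<in>P_set V G. D \<subseteq> C \<longrightarrow> D = C}"

section \<open>Spaces of right orders and of orders\<close>

definition right_order :: "'a pogroup \<Rightarrow> 'a rel \<Rightarrow> bool" where
  "right_order K r \<longleftrightarrow> right_preorder K r \<and> antisym r"

definition bi_order :: "'a pogroup \<Rightarrow> 'a rel \<Rightarrow> bool" where
  "bi_order K r \<longleftrightarrow> right_order K r \<and>
     (\<forall>a b. \<forall>s\<in>carrier K. (a, b) \<in> r \<longrightarrow> (s \<otimes>\<^bsub>K\<^esub> a, s \<otimes>\<^bsub>K\<^esub> b) \<in> r)"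

definition right_orders :: "'a pogroup \<Rightarrow> 'a set set" where
  "right_orders K = cone_of K ` {r. right_order K r}"

definition bi_orders :: "'a pogroup \<Rightarrow> 'a set set" where
  "bi_orders K = cone_of K ` {r. bi_order K r}"

definition R_space :: "'a pogroup \<Rightarrow> 'a set topology" where
  "R_space K = topology_generated_by (insert (right_orders K)
     ((\<lambda>a. {C \<in> right_orders K. a \<in> C}) ` carrier K \<union>
      (\<lambda>a. {C \<in> right_orders K. a \<notin> C}) ` carrier K))"

definition O_space :: "'a pogroup \<Rightarrow> 'a set topology" where
  "O_space K = subtopology (R_space K) (bi_orders K)"

section \<open>Free lattice-ordered groups over a partially ordered group\<close>

text \<open>The universal property with respect to the members of the variety carried by a type.\<close>

definition universal_on :: "'h itself \<Rightarrow> variety \<Rightarrow> 'a pogroup \<Rightarrow> 'f pogroup \<Rightarrow> ('a \<Rightarrow> 'f) \<Rightarrow> bool"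
  where
  "universal_on (_ :: 'h itself) V G F \<eta> \<longleftrightarrow>
     (\<forall>(H :: 'h pogroup) p. in_variety V H \<and> p \<in> pos_hom G H \<longrightarrow>
        (\<exists>!h. h \<in> extensional (carrier F) \<and> h \<in> l_hom F H \<and>
              (\<forall>a\<in>carrier G. h (\<eta> a) = p a)))"

text \<open>HOL cannot quantify over all types inside a formula, so the universal property is required
  on two types: that of \<open>F\<close> and that of the groups \<^const>\<open>H_grp\<close>. This is equivalent to having it on
  all types. The first forces \<open>F\<close> to be generated by the image of \<open>\<eta>\<close> (compare \<open>F\<close> with the
  \<open>\<ell>\<close>-subgroup so generated), whence uniqueness on all types. For existence, a positive homomorphism
  from \<open>G\<close> may be corestricted to the \<open>\<ell>\<close>-subgroup generated by its image. If \<open>G\<close> is infinite, this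
  has at most as many elements as \<open>G\<close>, hence a copy on the second type; if \<open>G\<close> is finite, it is
  trivial, \<open>\<ell>\<close>-groups being torsion-free.\<close>

definition free_over :: "variety \<Rightarrow> 'a pogroup \<Rightarrow> 'f pogroup \<Rightarrow> ('a \<Rightarrow> 'f) \<Rightarrow> bool" where
  "free_over V G F \<eta> \<longleftrightarrow> in_variety V F \<and> \<eta> \<in> pos_hom G F \<and>
     universal_on TYPE('f) V G F \<eta> \<and> universal_on TYPE('a set \<Rightarrow> 'a set) V G F \<eta>"

definition group_image :: "'a pogroup \<Rightarrow> 'f pogroup \<Rightarrow> ('a \<Rightarrow> 'f) \<Rightarrow> 'f pogroup" where
  "group_image G F \<eta> = F\<lparr>carrier := \<eta> ` carrier G\<rparr>"

end

theory Submission
  imports Defs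
begin

text \<open>Call a cone a \<open>V\<close>-cone if it is arbitrary, normal, or normal and containing all commutators,
  according to \<open>V\<close>. Every element of a group in \<open>V\<close> that is not positive is missed by a \<open>V\<close>-cone:
  by Holland's argument, with a maximal convex submonoid of the negative cone, or by a totally
  ordered factor of a subdirect representation. Pulling such cones back along \<open>R\<^sub>C\<close> and using
  compactness, every \<open>C\<close> in \<open>P\<^sub>V(G)\<close> contains a proper \<open>V\<close>-cone. The universal property, applied to
  \<open>R\<^sub>C\<close>, shows that \<open>C\<close> contains every \<open>a\<close> with \<open>\<eta> a\<close> positive. Refining a \<open>V\<close>-cone
  lexicographically by the pullback along \<open>\<eta>\<close> of a cone that misses \<open>\<eta> a\<close> then shows that the
  minimal elements are exactly the proper \<open>V\<close>-cones \<open>C\<close> with \<open>C \<inter> C\<^sup>-\<^sup>1\<close> the kernel of \<open>\<eta>\<close>, and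
  these are the preimages of the orders of \<open>\<eta>[G]\<close>.\<close>

section \<open>Joins and meets\<close>

text \<open>In the representable case \<open>H_C\<close> can lie in \<open>V\<close> although
  \<open>C\<close> is not normal, because \<open>C\<close> records only where the class of the
  identity is moved: in a totally ordered group with a convex subgroup \<open>S\<close> that is not
  normal, the elements above some element of \<open>S\<close> form such a \<open>C\<close>. Hence
  \<open>V\<close>-cones have to be sought below \<open>C\<close>, and membership of
  \<open>H_C\<close> in \<open>V\<close> enters only through the fact that the positive cone of a
  group in \<open>V\<close> is the intersection of its \<open>V\<close>-cones. Minimality is
  governed by the subgroup of all \<open>a\<close> with \<open>a\<close> and \<open>inv a\<close> in
  \<open>C\<close>. It always contains the kernel of \<open>\<eta>\<close>, since the translations
  by elements of \<open>G\<close> factor through \<open>F\<close>. For a \<open>V\<close>-cone it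
  can be cut down further as long as it exceeds the kernel, since the lexicographic refinement acts
  on this subgroup alone. The sets generating the topology of pre-cones ask for strict positivity of
  \<open>a\<close>, the subbase for orders only for membership or its failure. When \<open>C\<close>
  meets its inverse in the kernel only, strictness matters just for
  \<open>\<eta> a = \<one>\<close>, where the membership set is the whole space.\<close>

definition is_join :: "'a pogroup \<Rightarrow> 'a \<Rightarrow> 'a \<Rightarrow> 'a \<Rightarrow> bool" where
  "is_join G x y z \<longleftrightarrow> z \<in> carrier G \<and> x \<preceq>\<^bsub>G\<^esub> z \<and> y \<preceq>\<^bsub>G\<^esub> z \<and>
     (\<forall>w\<in>carrier G. x \<preceq>\<^bsub>G\<^esub> w \<longrightarrow> y \<preceq>\<^bsub>G\<^esub> w \<longrightarrow> z \<preceq>\<^bsub>G\<^esub> w)"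

definition is_meet :: "'a pogroup \<Rightarrow> 'a \<Rightarrow> 'a \<Rightarrow> 'a \<Rightarrow> bool" where
  "is_meet G x y z \<longleftrightarrow> z \<in> carrier G \<and> z \<preceq>\<^bsub>G\<^esub> x \<and> z \<preceq>\<^bsub>G\<^esub> y \<and>
     (\<forall>w\<in>carrier G. w \<preceq>\<^bsub>G\<^esub> x \<longrightarrow> w \<preceq>\<^bsub>G\<^esub> y \<longrightarrow> w \<preceq>\<^bsub>G\<^esub> z)"

lemma order_of_simps [simp]:
  "carrier (order_of G) = carrier G" "le (order_of G) = ple G" "eq (order_of G) = (=)"
  by (simp_all add: order_of_def)

lemma partial_order_order_ofI:
  assumes "\<And>x. x \<in> carrier G \<Longrightarrow> x \<preceq>\<^bsub>G\<^esub> x"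
    and "\<And>x y. x \<in> carrier G \<Longrightarrow> y \<in> carrier G \<Longrightarrow> x \<preceq>\<^bsub>G\<^esub> y \<Longrightarrow> y \<preceq>\<^bsub>G\<^esub> x \<Longrightarrow> x = y"
    and "\<And>x y z. x \<in> carrier G \<Longrightarrow> y \<in> carrier G \<Longrightarrow> z \<in> carrier G \<Longrightarrow>
      x \<preceq>\<^bsub>G\<^esub> y \<Longrightarrow> y \<preceq>\<^bsub>G\<^esub> z \<Longrightarrow> x \<preceq>\<^bsub>G\<^esub> z"
  shows "partial_order (order_of G)"
proof (unfold_locales, unfold order_of_simps)
  fix x y z
  assume "x \<preceq>\<^bsub>G\<^esub> y" "y \<preceq>\<^bsub>G\<^esub> z" "x \<in> carrier G" "y \<in> carrier G" "z \<in> carrier G"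
  then show "x \<preceq>\<^bsub>G\<^esub> z" by (rule assms(3)[rotated 3])
qed (auto intro: assms(1,2))

lemma is_join_unique:
  assumes "partial_order (order_of G)" "is_join G x y z" "is_join G x y w"
  shows "w = z"
  using partial_order.le_antisym[OF assms(1), of w z] assms(2,3) by (simp add: is_join_def)

lemma is_meet_unique:
  assumes "partial_order (order_of G)" "is_meet G x y z" "is_meet G x y w"
  shows "w = z"
  using partial_order.le_antisym[OF assms(1), of w z] assms(2,3) by (simp add: is_meet_def)

lemma least_Upper_pair_iff:
  assumes "x \<in> carrier G" "y \<in> carrier G"
  shows "least (order_of G) z (Upper (order_of G) {x, y}) \<longleftrightarrow> is_join G x y z"
  using assms by (auto simp: least_def Upper_def is_join_def)

lemma greatest_Lower_pair_iff:
  assumes "x \<in> carrier G" "y \<in> carrier G"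
  shows "greatest (order_of G) z (Lower (order_of G) {x, y}) \<longleftrightarrow> is_meet G x y z"
  using assms by (auto simp: greatest_def Lower_def is_meet_def)

text \<open>HOL-Algebra defines joins by \<open>SOME\<close> over least upper bounds. Antisymmetry
  makes the chosen element unique, so a join is computed by exhibiting any witness of
  \<open>is_join\<close>.\<close>

lemma join_eqI:
  assumes "partial_order (order_of G)" "x \<in> carrier G" "y \<in> carrier G" "is_join G x y z"
  shows "x \<squnion>\<^bsub>order_of G\<^esub> y = z"
proof -
  have "is_join G x y (SOME w. is_join G x y w)"
    using assms(4) by (rule someI)
  then have "(SOME w. is_join G x y w) = z"
    using is_join_unique[OF assms(1,4)] by blast
  then show ?thesis
    using assms(2,3) by (simp add: Lattice.join_def sup_def least_Upper_pair_iff)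
qed

lemma meet_eqI:
  assumes "partial_order (order_of G)" "x \<in> carrier G" "y \<in> carrier G" "is_meet G x y z"
  shows "x \<sqinter>\<^bsub>order_of G\<^esub> y = z"
proof -
  have "is_meet G x y (SOME w. is_meet G x y w)"
    using assms(4) by (rule someI)
  then have "(SOME w. is_meet G x y w) = z"
    using is_meet_unique[OF assms(1,4)] by blast
  then show ?thesis
    using assms(2,3) by (simp add: meet_def inf_def greatest_Lower_pair_iff)
qed

lemma lattice_order_of_iff:
  "lattice (order_of G) \<longleftrightarrow> partial_order (order_of G) \<and>
     (\<forall>x\<in>carrier G. \<forall>y\<in>carrier G. (\<exists>z. is_join G x y z) \<and> (\<exists>z. is_meet G x y z))"
  unfolding lattice_def upper_semilattice_def lower_semilattice_def
    upper_semilattice_axioms_def lower_semilattice_axioms_def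
  by (auto simp: least_Upper_pair_iff greatest_Lower_pair_iff)

lemma total_order_order_of_iff:
  "total_order (order_of G) \<longleftrightarrow> partial_order (order_of G) \<and>
     (\<forall>x\<in>carrier G. \<forall>y\<in>carrier G. x \<preceq>\<^bsub>G\<^esub> y \<or> y \<preceq>\<^bsub>G\<^esub> x)"
  unfolding total_order_def total_order_axioms_def by auto

section \<open>Arithmetic in partially ordered groups\<close>

locale po_grp = group G for G :: "'a pogroup" (structure) +
  assumes po_group: "po_group G"
begin

lemma partial_order: "partial_order (order_of G)"
  using po_group by (simp add: po_group_def)

lemma ple_refl: "x \<in> carrier G \<Longrightarrow> x \<preceq> x"
  using weak_partial_order.le_refl[OF partial_order.axioms(1)[OF partial_order], of x] by simp

lemma ple_antisym: "x \<in> carrier G \<Longrightarrow> y \<in> carrier G \<Longrightarrow> x \<preceq> y \<Longrightarrow> y \<preceq> x \<Longrightarrow> x = y"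
  using partial_order.le_antisym[OF partial_order, of x y] by simp

lemma ple_trans:
  "x \<in> carrier G \<Longrightarrow> y \<in> carrier G \<Longrightarrow> z \<in> carrier G \<Longrightarrow> x \<preceq> y \<Longrightarrow> y \<preceq> z \<Longrightarrow> x \<preceq> z"
  using weak_partial_order.le_trans[OF partial_order.axioms(1)[OF partial_order], of x y z] by simp

lemma mult_inv_cancel:
  assumes "a \<in> carrier G" "t \<in> carrier G"
  shows "inv t \<otimes> (t \<otimes> a) = a" "t \<otimes> (inv t \<otimes> a) = a"
  using assms by (simp_all add: m_assoc[symmetric])

lemma mult_left_mono:
  assumes "a \<in> carrier G" "b \<in> carrier G" "s \<in> carrier G" "a \<preceq> b"
  shows "s \<otimes> a \<preceq> s \<otimes> b"
proof -
  have "s \<otimes> a \<otimes> \<one> \<preceq> s \<otimes> b \<otimes> \<one>"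
    using po_group assms unfolding po_group_def by blast
  then show ?thesis using assms by simp
qed

lemma mult_right_mono:
  assumes "a \<in> carrier G" "b \<in> carrier G" "t \<in> carrier G" "a \<preceq> b"
  shows "a \<otimes> t \<preceq> b \<otimes> t"
proof -
  have "\<one> \<otimes> a \<otimes> t \<preceq> \<one> \<otimes> b \<otimes> t"
    using po_group assms unfolding po_group_def by blast
  then show ?thesis using assms by simp
qed

lemma mult_mono:
  assumes "a \<in> carrier G" "b \<in> carrier G" "c \<in> carrier G" "d \<in> carrier G" "a \<preceq> b" "c \<preceq> d"
  shows "a \<otimes> c \<preceq> b \<otimes> d"
  by (rule ple_trans[of _ "b \<otimes> c"]) (use assms in \<open>auto intro: mult_left_mono mult_right_mono\<close>)

lemma mult_both_mono:
  assumes "a \<in> carrier G" "b \<in> carrier G" "s \<in> carrier G" "t \<in> carrier G" "a \<preceq> b"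
  shows "s \<otimes> a \<otimes> t \<preceq> s \<otimes> b \<otimes> t"
  using assms by (intro mult_right_mono mult_left_mono) auto

lemma ple_iff_one_ple:
  assumes "a \<in> carrier G" "b \<in> carrier G"
  shows "a \<preceq> b \<longleftrightarrow> \<one> \<preceq> b \<otimes> inv a"
  using mult_right_mono[of a b "inv a"] mult_right_mono[of "\<one>" "b \<otimes> inv a" a] assms
  by (auto simp: m_assoc)

lemma inv_antimono:
  assumes "a \<in> carrier G" "b \<in> carrier G" "a \<preceq> b"
  shows "inv b \<preceq> inv a"
  using mult_left_mono[of "a \<otimes> inv b" "\<one>" "inv a"] mult_right_mono[of a b "inv b"] assms
  by (simp add: m_assoc[symmetric])

lemma one_ple_inv_iff:
  assumes "a \<in> carrier G"
  shows "\<one> \<preceq> inv a \<longleftrightarrow> a \<preceq> \<one>"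
  using inv_antimono[of "\<one>" "inv a"] inv_antimono[of a "\<one>"] assms by auto

end

lemma po_grpI: "po_group G \<Longrightarrow> po_grp G"
  by (simp add: po_grp_def po_grp_axioms_def po_group_def)

section \<open>Arithmetic in lattice-ordered groups\<close>

locale l_grp = po_grp G for G :: "'a pogroup" (structure) +
  assumes l_group: "l_group G"
begin

abbreviation join_G :: "'a \<Rightarrow> 'a \<Rightarrow> 'a" (infixl \<open>\<^bold>\<squnion>\<close> 65) where
  "x \<^bold>\<squnion> y \<equiv> x \<squnion>\<^bsub>order_of G\<^esub> y"

abbreviation meet_G :: "'a \<Rightarrow> 'a \<Rightarrow> 'a" (infixl \<open>\<^bold>\<sqinter>\<close> 70) where
  "x \<^bold>\<sqinter> y \<equiv> x \<sqinter>\<^bsub>order_of G\<^esub> y"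

lemma is_join_join:
  assumes "x \<in> carrier G" "y \<in> carrier G"
  shows "is_join G x y (x \<^bold>\<squnion> y)"
proof -
  obtain z where "is_join G x y z"
    using l_group assms unfolding l_group_def lattice_order_of_iff by blast
  then show ?thesis
    using join_eqI[OF partial_order assms] by simp
qed

lemma is_meet_meet:
  assumes "x \<in> carrier G" "y \<in> carrier G"
  shows "is_meet G x y (x \<^bold>\<sqinter> y)"
proof -
  obtain z where "is_meet G x y z"
    using l_group assms unfolding l_group_def lattice_order_of_iff by blast
  then show ?thesis
    using meet_eqI[OF partial_order assms] by simp
qed

lemma join_closed [simp]: "x \<in> carrier G \<Longrightarrow> y \<in> carrier G \<Longrightarrow> x \<^bold>\<squnion> y \<in> carrier G"
  and join_ge1: "x \<in> carrier G \<Longrightarrow> y \<in> carrier G \<Longrightarrow> x \<preceq> x \<^bold>\<squnion> y"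
  and join_ge2: "x \<in> carrier G \<Longrightarrow> y \<in> carrier G \<Longrightarrow> y \<preceq> x \<^bold>\<squnion> y"
  and join_least: "x \<in> carrier G \<Longrightarrow> y \<in> carrier G \<Longrightarrow> w \<in> carrier G \<Longrightarrow>
    x \<preceq> w \<Longrightarrow> y \<preceq> w \<Longrightarrow> x \<^bold>\<squnion> y \<preceq> w"
  using is_join_join unfolding is_join_def by blast+

lemma meet_closed [simp]: "x \<in> carrier G \<Longrightarrow> y \<in> carrier G \<Longrightarrow> x \<^bold>\<sqinter> y \<in> carrier G"
  and meet_le1: "x \<in> carrier G \<Longrightarrow> y \<in> carrier G \<Longrightarrow> x \<^bold>\<sqinter> y \<preceq> x"
  and meet_le2: "x \<in> carrier G \<Longrightarrow> y \<in> carrier G \<Longrightarrow> x \<^bold>\<sqinter> y \<preceq> y"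
  and meet_greatest: "x \<in> carrier G \<Longrightarrow> y \<in> carrier G \<Longrightarrow> w \<in> carrier G \<Longrightarrow>
    w \<preceq> x \<Longrightarrow> w \<preceq> y \<Longrightarrow> w \<preceq> x \<^bold>\<sqinter> y"
  using is_meet_meet unfolding is_meet_def by blast+

lemma join_absorb2: "x \<in> carrier G \<Longrightarrow> y \<in> carrier G \<Longrightarrow> x \<preceq> y \<Longrightarrow> x \<^bold>\<squnion> y = y"
  by (intro join_eqI partial_order) (auto simp: is_join_def ple_refl)

lemma join_absorb1: "x \<in> carrier G \<Longrightarrow> y \<in> carrier G \<Longrightarrow> y \<preceq> x \<Longrightarrow> x \<^bold>\<squnion> y = x"
  by (intro join_eqI partial_order) (auto simp: is_join_def ple_refl)

lemma meet_absorb1: "x \<in> carrier G \<Longrightarrow> y \<in> carrier G \<Longrightarrow> x \<preceq> y \<Longrightarrow> x \<^bold>\<sqinter> y = x"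
  by (intro meet_eqI partial_order) (auto simp: is_meet_def ple_refl)

text \<open>Multiplication by \<open>inv z\<close> moves the factor \<open>z\<close> to the other
  side, where leastness of the join applies.\<close>

lemma mult_join_le:
  assumes "x \<in> carrier G" "y \<in> carrier G" "z \<in> carrier G" "w \<in> carrier G"
    and "z \<otimes> x \<preceq> w" "z \<otimes> y \<preceq> w"
  shows "z \<otimes> (x \<^bold>\<squnion> y) \<preceq> w"
proof -
  have "v \<preceq> inv z \<otimes> w" if "v \<in> carrier G" "z \<otimes> v \<preceq> w" for v
    using mult_left_mono[of "z \<otimes> v" w "inv z"] that assms by (simp add: m_assoc[symmetric])
  then have "x \<^bold>\<squnion> y \<preceq> inv z \<otimes> w"
    using assms by (intro join_least) auto
  then have "z \<otimes> (x \<^bold>\<squnion> y) \<preceq> z \<otimes> (inv z \<otimes> w)"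
    using assms by (intro mult_left_mono) auto
  then show ?thesis
    using assms by (simp add: m_assoc[symmetric])
qed

lemma join_mult_le:
  assumes "x \<in> carrier G" "y \<in> carrier G" "z \<in> carrier G" "w \<in> carrier G"
    and "x \<otimes> z \<preceq> w" "y \<otimes> z \<preceq> w"
  shows "(x \<^bold>\<squnion> y) \<otimes> z \<preceq> w"
proof -
  have "v \<preceq> w \<otimes> inv z" if "v \<in> carrier G" "v \<otimes> z \<preceq> w" for v
    using mult_right_mono[of "v \<otimes> z" w "inv z"] that assms by (simp add: m_assoc)
  then have "x \<^bold>\<squnion> y \<preceq> w \<otimes> inv z"
    using assms by (intro join_least) auto
  then have "(x \<^bold>\<squnion> y) \<otimes> z \<preceq> w \<otimes> inv z \<otimes> z"
    using assms by (intro mult_right_mono) auto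
  then show ?thesis
    using assms by (simp add: m_assoc)
qed

end

lemma l_grpI: "l_group G \<Longrightarrow> l_grp G"
  by (simp add: l_grp_def l_grp_axioms_def po_grpI l_group_def)

lemma to_group_imp_l_group:
  assumes "to_group G"
  shows "l_group G"
proof -
  interpret po_grp G using assms by (simp add: to_group_def po_grpI)
  have tot: "x \<preceq>\<^bsub>G\<^esub> y \<or> y \<preceq>\<^bsub>G\<^esub> x" if "x \<in> carrier G" "y \<in> carrier G" for x y
    using assms that unfolding to_group_def total_order_order_of_iff by blast
  have "\<exists>z. is_join G x y z" "\<exists>z. is_meet G x y z" if xy: "x \<in> carrier G" "y \<in> carrier G" for x y
    using tot[OF xy] xy ple_refl unfolding is_join_def is_meet_def by blast+
  then show ?thesis
    using assms partial_order unfolding l_group_def lattice_order_of_iff to_group_def by blast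
qed

lemma in_variety_imp_l_group: "in_variety V G \<Longrightarrow> l_group G"
  by (cases V) (auto simp: representable_def)

lemma l_hom_join:
  "h \<in> l_hom G H \<Longrightarrow> a \<in> carrier G \<Longrightarrow> b \<in> carrier G \<Longrightarrow>
    h (a \<squnion>\<^bsub>order_of G\<^esub> b) = h a \<squnion>\<^bsub>order_of H\<^esub> h b"
  by (simp add: l_hom_def)

text \<open>The order of an l-group is recovered from its joins: \<open>a\<close> lies below
  \<open>b\<close> exactly if their join is \<open>b\<close>.\<close>

lemma l_hom_imp_pos_hom:
  assumes "l_group G" "l_group H" "h \<in> l_hom G H"
  shows "h \<in> pos_hom G H"
proof -
  interpret G: l_grp G using assms(1) by (rule l_grpI)
  interpret H: l_grp H using assms(2) by (rule l_grpI)
  have hom: "h \<in> hom G H" using assms(3) by (simp add: l_hom_def)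
  have "h a \<preceq>\<^bsub>H\<^esub> h b" if ab: "a \<in> carrier G" "b \<in> carrier G" "a \<preceq>\<^bsub>G\<^esub> b" for a b
  proof -
    have "h a \<squnion>\<^bsub>order_of H\<^esub> h b = h b"
      using l_hom_join[OF assms(3) ab(1,2)] G.join_absorb2[OF ab] by simp
    then show ?thesis
      using H.join_ge1[of "h a" "h b"] ab hom_in_carrier[OF hom] by auto
  qed
  then show ?thesis using hom by (simp add: pos_hom_def)
qed

section \<open>Cones\<close>

text \<open>Admitting \<open>C = G\<close> keeps these cones stable under preimages along arbitrary
  positive homomorphisms and makes compactness available. Properness comes back for free wherever a
  cone lies inside a proper one.\<close>

definition total_cone :: "'a pogroup \<Rightarrow> 'a set \<Rightarrow> bool" where
  "total_cone G C \<longleftrightarrow> C \<subseteq> carrier G \<and>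
     (\<forall>a\<in>carrier G. \<one>\<^bsub>G\<^esub> \<preceq>\<^bsub>G\<^esub> a \<longrightarrow> a \<in> C) \<and>
     (\<forall>a\<in>C. \<forall>b\<in>C. a \<otimes>\<^bsub>G\<^esub> b \<in> C) \<and>
     (\<forall>a\<in>carrier G. a \<in> C \<or> inv\<^bsub>G\<^esub> a \<in> C)"

text \<open>If \<open>V\<close> is not \<^const>\<open>All\<close>, these are the cones \<open>C\<close> for which \<open>H\<^sub>C\<close> is a totally ordered
  group in \<open>V\<close>. The improper cone \<open>C = G\<close> is allowed.\<close>

definition variety_cone :: "variety \<Rightarrow> 'a pogroup \<Rightarrow> 'a set \<Rightarrow> bool" where
  "variety_cone V G C \<longleftrightarrow> total_cone G C \<and>
     (V \<noteq> All \<longrightarrow> (\<forall>g\<in>carrier G. \<forall>a\<in>C. g \<otimes>\<^bsub>G\<^esub> a \<otimes>\<^bsub>G\<^esub> inv\<^bsub>G\<^esub> g \<in> C)) \<and>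
     (V = Abelian \<longrightarrow>
        (\<forall>a\<in>carrier G. \<forall>b\<in>carrier G. a \<otimes>\<^bsub>G\<^esub> b \<otimes>\<^bsub>G\<^esub> inv\<^bsub>G\<^esub> (b \<otimes>\<^bsub>G\<^esub> a) \<in> C))"

lemma total_coneI:
  assumes "C \<subseteq> carrier G"
    and "\<And>a. a \<in> carrier G \<Longrightarrow> \<one>\<^bsub>G\<^esub> \<preceq>\<^bsub>G\<^esub> a \<Longrightarrow> a \<in> C"
    and "\<And>a b. a \<in> C \<Longrightarrow> b \<in> C \<Longrightarrow> a \<otimes>\<^bsub>G\<^esub> b \<in> C"
    and "\<And>a. a \<in> carrier G \<Longrightarrow> a \<notin> C \<Longrightarrow> inv\<^bsub>G\<^esub> a \<in> C"
  shows "total_cone G C"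
  unfolding total_cone_def using assms by blast

lemma total_cone_subset: "total_cone G C \<Longrightarrow> C \<subseteq> carrier G"
  unfolding total_cone_def by blast

lemma total_cone_pos: "total_cone G C \<Longrightarrow> a \<in> carrier G \<Longrightarrow> \<one>\<^bsub>G\<^esub> \<preceq>\<^bsub>G\<^esub> a \<Longrightarrow> a \<in> C"
  unfolding total_cone_def by blast

lemma total_cone_mult: "total_cone G C \<Longrightarrow> a \<in> C \<Longrightarrow> b \<in> C \<Longrightarrow> a \<otimes>\<^bsub>G\<^esub> b \<in> C"
  unfolding total_cone_def by blast

lemma total_cone_total: "total_cone G C \<Longrightarrow> a \<in> carrier G \<Longrightarrow> a \<notin> C \<Longrightarrow> inv\<^bsub>G\<^esub> a \<in> C"
  unfolding total_cone_def by blast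

lemma total_cone_one: "po_group G \<Longrightarrow> total_cone G C \<Longrightarrow> \<one>\<^bsub>G\<^esub> \<in> C"
  using total_cone_pos[of G C "\<one>\<^bsub>G\<^esub>"] by (simp add: po_grp.ple_refl po_grpI po_group_def group.is_monoid)

lemma variety_cone_total: "variety_cone V G C \<Longrightarrow> total_cone G C"
  unfolding variety_cone_def by blast

lemma variety_cone_conj:
  "variety_cone V G C \<Longrightarrow> V \<noteq> All \<Longrightarrow> g \<in> carrier G \<Longrightarrow> a \<in> C \<Longrightarrow>
    g \<otimes>\<^bsub>G\<^esub> a \<otimes>\<^bsub>G\<^esub> inv\<^bsub>G\<^esub> g \<in> C"
  unfolding variety_cone_def by blast

lemma variety_cone_commutator:
  "variety_cone V G C \<Longrightarrow> V = Abelian \<Longrightarrow> a \<in> carrier G \<Longrightarrow> b \<in> carrier G \<Longrightarrow>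
    a \<otimes>\<^bsub>G\<^esub> b \<otimes>\<^bsub>G\<^esub> inv\<^bsub>G\<^esub> (b \<otimes>\<^bsub>G\<^esub> a) \<in> C"
  unfolding variety_cone_def by blast

lemma variety_coneI:
  assumes "total_cone G C"
    and "\<And>g a. V \<noteq> All \<Longrightarrow> g \<in> carrier G \<Longrightarrow> a \<in> C \<Longrightarrow> g \<otimes>\<^bsub>G\<^esub> a \<otimes>\<^bsub>G\<^esub> inv\<^bsub>G\<^esub> g \<in> C"
    and "\<And>a b. V = Abelian \<Longrightarrow> a \<in> carrier G \<Longrightarrow> b \<in> carrier G \<Longrightarrow>
      a \<otimes>\<^bsub>G\<^esub> b \<otimes>\<^bsub>G\<^esub> inv\<^bsub>G\<^esub> (b \<otimes>\<^bsub>G\<^esub> a) \<in> C"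
  shows "variety_cone V G C"
  unfolding variety_cone_def using assms by blast

lemma variety_cone_vimage:
  assumes "po_group G" "po_group H" "p \<in> pos_hom G H" "variety_cone V H D"
  shows "variety_cone V G {a \<in> carrier G. p a \<in> D}"
proof -
  interpret G: po_grp G using assms(1) by (rule po_grpI)
  interpret H: po_grp H using assms(2) by (rule po_grpI)
  have hom: "p \<in> hom G H"
    and mono: "a \<in> carrier G \<Longrightarrow> b \<in> carrier G \<Longrightarrow> a \<preceq>\<^bsub>G\<^esub> b \<Longrightarrow> p a \<preceq>\<^bsub>H\<^esub> p b" for a b
    using assms(3) by (simp_all add: pos_hom_def)
  interpret group_hom G H p
    by unfold_locales (rule hom)
  have tot: "total_cone H D" using assms(4) by (rule variety_cone_total)
  show ?thesis
  proof (rule variety_coneI)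
    show "total_cone G {a \<in> carrier G. p a \<in> D}"
    proof (rule total_coneI)
      fix a assume a: "a \<in> carrier G" "\<one>\<^bsub>G\<^esub> \<preceq>\<^bsub>G\<^esub> a"
      then have "\<one>\<^bsub>H\<^esub> \<preceq>\<^bsub>H\<^esub> p a" using mono[of "\<one>\<^bsub>G\<^esub>" a] by simp
      then show "a \<in> {a \<in> carrier G. p a \<in> D}"
        using total_cone_pos[OF tot, of "p a"] a by simp
    next
      fix a assume "a \<in> carrier G" "a \<notin> {a \<in> carrier G. p a \<in> D}"
      then show "inv\<^bsub>G\<^esub> a \<in> {a \<in> carrier G. p a \<in> D}"
        using total_cone_total[OF tot, of "p a"] by simp
    qed (use total_cone_mult[OF tot] in auto)
  next
    fix g a assume "V \<noteq> All" "g \<in> carrier G" "a \<in> {a \<in> carrier G. p a \<in> D}"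
    then show "g \<otimes>\<^bsub>G\<^esub> a \<otimes>\<^bsub>G\<^esub> inv\<^bsub>G\<^esub> g \<in> {a \<in> carrier G. p a \<in> D}"
      using variety_cone_conj[OF assms(4), of "p g" "p a"] by simp
  next
    fix a b assume "V = Abelian" "a \<in> carrier G" "b \<in> carrier G"
    then show "a \<otimes>\<^bsub>G\<^esub> b \<otimes>\<^bsub>G\<^esub> inv\<^bsub>G\<^esub> (b \<otimes>\<^bsub>G\<^esub> a) \<in> {a \<in> carrier G. p a \<in> D}"
      using variety_cone_commutator[OF assms(4), of "p a" "p b"] by simp
  qed
qed

text \<open>The lexicographic product of two preorders: \<open>C\<close> decides, and
  \<open>D\<close> breaks the ties, which are the elements lying in \<open>C\<close> together with
  their inverses.\<close>

lemma variety_cone_lex: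
  fixes G (structure)
  assumes "po_group G" "variety_cone V G C" "variety_cone V G D"
  shows "variety_cone V G {a \<in> C. inv\<^bsub>G\<^esub> a \<in> C \<longrightarrow> a \<in> D}"
proof -
  interpret po_grp G using assms(1) by (rule po_grpI)
  note C = variety_cone_total[OF assms(2)] and D = variety_cone_total[OF assms(3)]
  note CG = subsetD[OF total_cone_subset[OF C]]
  let ?L = "{a \<in> C. inv a \<in> C \<longrightarrow> a \<in> D}"
  show ?thesis
  proof (rule variety_coneI)
    show "total_cone G ?L"
    proof (rule total_coneI)
      show "?L \<subseteq> carrier G" using CG by blast
      show "a \<in> ?L" if "a \<in> carrier G" "\<one> \<preceq> a" for a
        using total_cone_pos[OF C that] total_cone_pos[OF D that] by simp
      show "a \<otimes> b \<in> ?L" if ab: "a \<in> ?L" "b \<in> ?L" for a b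
      proof -
        have [simp]: "a \<in> carrier G" "b \<in> carrier G" using ab CG by auto
        \<comment> \<open>A tie at a product of members of \<open>C\<close> is a tie at both
          factors, because \<open>inv a = b \<otimes> inv (a \<otimes> b)\<close> and
          \<open>inv b = inv (a \<otimes> b) \<otimes> a\<close>. So \<open>D\<close> contains both
          factors and hence the product.\<close>
        have "inv a \<in> C" if "inv (a \<otimes> b) \<in> C"
          using total_cone_mult[OF C, of b "inv (a \<otimes> b)"] ab that
          by (simp add: inv_mult_group m_assoc[symmetric])
        moreover have "inv b \<in> C" if "inv (a \<otimes> b) \<in> C"
          using total_cone_mult[OF C, of "inv (a \<otimes> b)" a] ab that
          by (simp add: inv_mult_group m_assoc)
        ultimately show ?thesis
          using ab total_cone_mult[OF C, of a b] total_cone_mult[OF D, of a b] by blast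
      qed
      show "inv a \<in> ?L" if "a \<in> carrier G" "a \<notin> ?L" for a
        using that total_cone_total[OF C, of a] total_cone_total[OF D, of a] by auto
    qed
    show "g \<otimes> a \<otimes> inv g \<in> ?L" if V: "V \<noteq> All" and g: "g \<in> carrier G" and a: "a \<in> ?L" for g a
    proof -
      have aG: "a \<in> carrier G" using a CG by auto
      \<comment> \<open>Conjugating back by \<open>inv g\<close> shows that a tie at the conjugate
        is a tie at \<open>a\<close>.\<close>
      have "inv a \<in> C" if "inv (g \<otimes> a \<otimes> inv g) \<in> C"
        using variety_cone_conj[OF assms(2) V, of "inv g" "inv (g \<otimes> a \<otimes> inv g)"] g aG that
        by (simp add: inv_mult_group m_assoc mult_inv_cancel)
      then show ?thesis
        using a variety_cone_conj[OF assms(2) V g, of a] variety_cone_conj[OF assms(3) V g, of a] by blast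
    qed
    show "a \<otimes> b \<otimes> inv (b \<otimes> a) \<in> ?L" if V: "V = Abelian" and ab: "a \<in> carrier G" "b \<in> carrier G" for a b
      using variety_cone_commutator[OF assms(2) V ab] variety_cone_commutator[OF assms(3) V ab] by simp
  qed
qed

text \<open>Compactness of the space of all cones: a maximal set containing \<open>N\<close> all of whose finite
  subsets are missed by a cone is the complement of a cone.\<close>

lemma variety_cone_avoiding:
  fixes G (structure)
  assumes "po_group G" "N \<subseteq> carrier G"
    and "\<And>A. finite A \<Longrightarrow> A \<subseteq> N \<Longrightarrow> \<exists>C. variety_cone V G C \<and> A \<inter> C = {}"
  shows "\<exists>C. variety_cone V G C \<and> N \<inter> C = {}"
proof -
  interpret po_grp G using assms(1) by (rule po_grpI)
  define avoidable where
    "avoidable S \<longleftrightarrow> (\<forall>A. finite A \<longrightarrow> A \<subseteq> S \<longrightarrow> (\<exists>C. variety_cone V G C \<and> A \<inter> C = {}))" for S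
  define \<S> where "\<S> = {S. N \<subseteq> S \<and> S \<subseteq> carrier G \<and> avoidable S}"
  have "\<exists>M\<in>\<S>. \<forall>X\<in>\<S>. M \<subseteq> X \<longrightarrow> X = M"
  proof (rule subset_Zorn_nonempty)
    show "\<S> \<noteq> {}" using assms by (auto simp: \<S>_def avoidable_def)
    fix \<C> assume \<C>: "\<C> \<noteq> {}" "subset.chain \<S> \<C>"
    have "avoidable (\<Union>\<C>)"
      unfolding avoidable_def
    proof (intro allI impI)
      fix A assume A: "finite A" "A \<subseteq> \<Union>\<C>"
      obtain S where "S \<in> \<C>" "A \<subseteq> S"
        using finite_subset_Union_chain[OF A \<C>] by blast
      then show "\<exists>C. variety_cone V G C \<and> A \<inter> C = {}"
        using \<C>(2) A(1) unfolding subset.chain_def \<S>_def avoidable_def by blast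
    qed
    then show "\<Union>\<C> \<in> \<S>"
      using \<C> unfolding \<S>_def subset.chain_def by blast
  qed
  then obtain M where M: "M \<in> \<S>" and max: "\<And>X. X \<in> \<S> \<Longrightarrow> M \<subseteq> X \<Longrightarrow> X = M" by blast
  have MG: "N \<subseteq> M" "M \<subseteq> carrier G" and avoid: "avoidable M" using M by (auto simp: \<S>_def)
  \<comment> \<open>Adding \<open>a\<close> to the maximal set \<open>M\<close> destroys
    avoidability. Removing \<open>a\<close> from the finite witness leaves a finite part of
    \<open>M\<close> such that every cone missing it must contain \<open>a\<close>.\<close>
  have blocked: "\<exists>A. finite A \<and> A \<subseteq> M \<and> (\<forall>C. variety_cone V G C \<longrightarrow> A \<inter> C = {} \<longrightarrow> a \<in> C)"
    if "a \<in> carrier G - M" for a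
  proof -
    have "insert a M \<notin> \<S>" using max[of "insert a M"] that by blast
    then have "\<not> avoidable (insert a M)" using that MG unfolding \<S>_def by blast
    then obtain A where A: "finite A" "A \<subseteq> insert a M" "\<And>C. variety_cone V G C \<Longrightarrow> A \<inter> C \<noteq> {}"
      unfolding avoidable_def by blast
    then show ?thesis by (intro exI[of _ "A - {a}"]) auto
  qed
  \<comment> \<open>The closure conditions on a \<open>V\<close>-cone let at most two members force
    a third. If \<open>c\<close> were in \<open>M\<close>, some cone would miss \<open>c\<close>
    along with the finite sets that force \<open>a\<close> and \<open>b\<close>, yet it would
    contain \<open>a\<close> and \<open>b\<close>, hence \<open>c\<close>.\<close>
  have closed: "c \<in> carrier G - M"
    if a: "a \<in> carrier G - M" and b: "b \<in> carrier G - M" and cG: "c \<in> carrier G"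
      and step: "\<And>C. variety_cone V G C \<Longrightarrow> a \<in> C \<Longrightarrow> b \<in> C \<Longrightarrow> c \<in> C" for a b c
  proof (rule ccontr)
    assume "c \<notin> carrier G - M"
    then have c: "c \<in> M" using cG by blast
    obtain A where A: "finite A" "A \<subseteq> M" "\<And>C. variety_cone V G C \<Longrightarrow> A \<inter> C = {} \<Longrightarrow> a \<in> C"
      using blocked[OF a] by blast
    obtain B where B: "finite B" "B \<subseteq> M" "\<And>C. variety_cone V G C \<Longrightarrow> B \<inter> C = {} \<Longrightarrow> b \<in> C"
      using blocked[OF b] by blast
    obtain C where "variety_cone V G C" "insert c (A \<union> B) \<inter> C = {}"
      using avoid A(1,2) B(1,2) c unfolding avoidable_def
      by (meson finite_UnI finite_insert insert_subset Un_least)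
    then show False using A(3)[of C] B(3)[of C] step[of C] by blast
  qed
  have always: "c \<in> carrier G - M"
    if "c \<in> carrier G" and step: "\<And>C. variety_cone V G C \<Longrightarrow> c \<in> C" for c
  proof (rule ccontr)
    assume "c \<notin> carrier G - M"
    then have "finite {c}" "{c} \<subseteq> M" using that by auto
    then obtain C where "variety_cone V G C" "{c} \<inter> C = {}"
      using avoid unfolding avoidable_def by blast
    then show False using step[of C] by blast
  qed
  have "variety_cone V G (carrier G - M)"
  proof (rule variety_coneI)
    show "total_cone G (carrier G - M)"
    proof (rule total_coneI)
      show "a \<in> carrier G - M" if "a \<in> carrier G" "\<one> \<preceq> a" for a
        by (rule always) (use that in \<open>auto intro: total_cone_pos variety_cone_total\<close>)
      show "a \<otimes> b \<in> carrier G - M" if "a \<in> carrier G - M" "b \<in> carrier G - M" for a b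
        by (rule closed[OF that]) (use that in \<open>auto intro: total_cone_mult variety_cone_total\<close>)
      \<comment> \<open>No cone misses both \<open>a\<close> and \<open>inv a\<close>, so this pair
        cannot be a finite subset of \<open>M\<close>.\<close>
      show "inv a \<in> carrier G - M" if a: "a \<in> carrier G" "a \<notin> carrier G - M" for a
      proof (rule ccontr)
        assume "inv a \<notin> carrier G - M"
        then have "finite {a, inv a}" "{a, inv a} \<subseteq> M" using a by auto
        then obtain C where "variety_cone V G C" "{a, inv a} \<inter> C = {}"
          using avoid unfolding avoidable_def by blast
        then show False
          using a total_cone_total[of G C a] variety_cone_total[of V G C] by blast
      qed
    qed blast
    show "g \<otimes> a \<otimes> inv g \<in> carrier G - M"
      if "V \<noteq> All" "g \<in> carrier G" "a \<in> carrier G - M" for g a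
      by (rule closed[OF that(3,3)]) (use that variety_cone_conj in auto)
    show "a \<otimes> b \<otimes> inv (b \<otimes> a) \<in> carrier G - M"
      if "V = Abelian" "a \<in> carrier G" "b \<in> carrier G" for a b
      by (rule always) (use that variety_cone_commutator in auto)
  qed
  then show ?thesis using MG by blast
qed

section \<open>Cones separating an element from the positive cone\<close>

text \<open>In an l-group these are the negative parts of the convex l-subgroups and determine them.
  The negative side is chosen because membership of \<open>g\<close> in the cone to be built depends
  on \<open>g \<sqinter> \<one>\<close>, that is, on how far \<open>g\<close> falls below the
  identity.\<close>

definition convex_neg_submonoid :: "'a pogroup \<Rightarrow> 'a set \<Rightarrow> bool" where
  "convex_neg_submonoid G M \<longleftrightarrow> \<one>\<^bsub>G\<^esub> \<in> M \<and> (\<forall>x\<in>M. x \<in> carrier G \<and> x \<preceq>\<^bsub>G\<^esub> \<one>\<^bsub>G\<^esub>) \<and>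
     (\<forall>x\<in>M. \<forall>y\<in>M. x \<otimes>\<^bsub>G\<^esub> y \<in> M) \<and>
     (\<forall>x\<in>M. \<forall>y\<in>carrier G. x \<preceq>\<^bsub>G\<^esub> y \<longrightarrow> y \<preceq>\<^bsub>G\<^esub> \<one>\<^bsub>G\<^esub> \<longrightarrow> y \<in> M)"

lemma convex_neg_submonoidD:
  assumes "convex_neg_submonoid G M"
  shows "\<one>\<^bsub>G\<^esub> \<in> M"
    and "x \<in> M \<Longrightarrow> x \<in> carrier G"
    and "x \<in> M \<Longrightarrow> x \<preceq>\<^bsub>G\<^esub> \<one>\<^bsub>G\<^esub>"
    and "x \<in> M \<Longrightarrow> y \<in> M \<Longrightarrow> x \<otimes>\<^bsub>G\<^esub> y \<in> M"
    and "x \<in> M \<Longrightarrow> y \<in> carrier G \<Longrightarrow> x \<preceq>\<^bsub>G\<^esub> y \<Longrightarrow> y \<preceq>\<^bsub>G\<^esub> \<one>\<^bsub>G\<^esub> \<Longrightarrow> y \<in> M"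
  using assms unfolding convex_neg_submonoid_def by blast+

context l_grp
begin

text \<open>The negative parts of \<open>g\<close> and \<open>inv g\<close> are orthogonal. If
  \<open>j\<close> is their join and \<open>a = g \<sqinter> \<one>\<close>, then \<open>j\<close>
  lies above \<open>a\<close> and above \<open>inv g \<otimes> a\<close>. Hence
  \<open>a \<otimes> inv j\<close> lies below \<open>\<one>\<close> and below \<open>g\<close>, so
  below \<open>a\<close>, which forces \<open>\<one> \<preceq> j\<close>.\<close>

lemma meet_inv_join:
  assumes "g \<in> carrier G"
  shows "(g \<^bold>\<sqinter> \<one>) \<^bold>\<squnion> (inv g \<^bold>\<sqinter> \<one>) = \<one>"
proof -
  let ?a = "g \<^bold>\<sqinter> \<one>" and ?b = "inv g \<^bold>\<sqinter> \<one>"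
  have le: "inv g \<otimes> ?a \<preceq> ?b"
  proof (rule meet_greatest)
    show "inv g \<otimes> ?a \<preceq> inv g"
      using mult_left_mono[of ?a \<one> "inv g"] meet_le2[of g \<one>] assms by simp
    show "inv g \<otimes> ?a \<preceq> \<one>"
      using mult_left_mono[of ?a g "inv g"] meet_le1[of g \<one>] assms by simp
  qed (use assms in auto)
  let ?j = "?a \<^bold>\<squnion> ?b"
  have j: "?j \<in> carrier G" using assms by simp
  have "inv g \<otimes> ?a \<preceq> ?j"
    by (rule ple_trans[OF _ _ _ le]) (use assms in \<open>auto intro: join_ge2\<close>)
  then have "inv g \<preceq> ?j \<otimes> inv ?a"
    using mult_right_mono[of "inv g \<otimes> ?a" ?j "inv ?a"] assms by (simp add: m_assoc)
  moreover have "\<one> \<preceq> ?j \<otimes> inv ?a"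
    using mult_right_mono[of ?a ?j "inv ?a"] join_ge1[of ?a ?b] assms by simp
  ultimately have inv_le: "inv (?j \<otimes> inv ?a) \<preceq> g" "inv (?j \<otimes> inv ?a) \<preceq> \<one>"
    using inv_antimono[of "inv g" "?j \<otimes> inv ?a"] inv_antimono[of \<one> "?j \<otimes> inv ?a"] assms by simp_all
  have "inv (?j \<otimes> inv ?a) \<preceq> ?a"
    using inv_le assms by (intro meet_greatest) auto
  then have "\<one> \<preceq> ?j"
    using mult_left_mono[of "inv (?j \<otimes> inv ?a)" ?a "inv ?a"]
      mult_right_mono[of "?a \<otimes> inv ?j" ?a "inv ?a"] inv_antimono[of "inv ?j" \<one>] assms
    by (simp add: inv_mult_group m_assoc[symmetric])
  moreover have "?j \<preceq> \<one>"
    using assms by (intro join_least) (auto intro: meet_le2)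
  ultimately show ?thesis
    using ple_antisym[of ?j \<one>] j by simp
qed

text \<open>On expanding the product, every term other than \<open>a \<otimes> b\<close> has a
  factor \<open>c\<close> whose cofactor is at most the identity, so it stays below
  \<open>c\<close>.\<close>

lemma mult_join_join_le:
  assumes "a \<in> carrier G" "b \<in> carrier G" "c \<in> carrier G" "a \<preceq> \<one>" "b \<preceq> \<one>" "c \<preceq> \<one>"
  shows "(a \<^bold>\<squnion> c) \<otimes> (b \<^bold>\<squnion> c) \<preceq> (a \<otimes> b) \<^bold>\<squnion> c"
proof -
  have c: "x \<preceq> (a \<otimes> b) \<^bold>\<squnion> c" if "x \<in> carrier G" "x \<preceq> c" for x
    by (rule ple_trans[OF _ _ _ that(2)]) (use assms that in \<open>auto intro: join_ge2\<close>)
  have "(a \<^bold>\<squnion> c) \<otimes> b \<preceq> (a \<otimes> b) \<^bold>\<squnion> c"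
    using c[of "c \<otimes> b"] mult_left_mono[of b \<one> c] join_ge1[of "a \<otimes> b" c] assms
    by (intro join_mult_le) auto
  moreover have "a \<^bold>\<squnion> c \<preceq> \<one>" using assms by (intro join_least) auto
  then have "(a \<^bold>\<squnion> c) \<otimes> c \<preceq> (a \<otimes> b) \<^bold>\<squnion> c"
    using c[of "(a \<^bold>\<squnion> c) \<otimes> c"] mult_right_mono[of "a \<^bold>\<squnion> c" \<one> c] assms by simp
  ultimately show ?thesis
    using assms by (intro mult_join_le) auto
qed

text \<open>The set \<open>{z \<le> \<one>. z \<squnion> c \<in> M}\<close> is a convex submonoid; this replaces distributivity and the
  description of the submonoid generated by \<open>M\<close> and an element.\<close>

lemma convex_neg_submonoid_join:
  assumes M: "convex_neg_submonoid G M" and c: "c \<in> carrier G" "c \<preceq> \<one>"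
  shows "convex_neg_submonoid G {z \<in> carrier G. z \<preceq> \<one> \<and> z \<^bold>\<squnion> c \<in> M}" (is "convex_neg_submonoid G ?N")
    and "M \<subseteq> {z \<in> carrier G. z \<preceq> \<one> \<and> z \<^bold>\<squnion> c \<in> M}"
proof -
  note D = convex_neg_submonoidD[OF M]
  have up: "y \<^bold>\<squnion> c \<in> M" if "x \<in> M" "y \<in> carrier G" "y \<preceq> \<one>" "x \<preceq> y \<^bold>\<squnion> c" for x y
    by (rule D(5)[OF that(1) _ that(4)]) (use that c in \<open>auto intro: join_least\<close>)
  show sub: "M \<subseteq> ?N"
    using up D(2,3) c join_ge1 by blast
  have "a \<otimes> b \<in> ?N" if "a \<in> ?N" "b \<in> ?N" for a b
  proof -
    have "a \<otimes> b \<preceq> \<one>" using mult_mono[of a \<one> b \<one>] that by simp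
    then show ?thesis
      using up[OF D(4)[of "a \<^bold>\<squnion> c" "b \<^bold>\<squnion> c"], of "a \<otimes> b"] mult_join_join_le[of a b c] that c by simp
  qed
  moreover have "b \<in> ?N" if "a \<in> ?N" "b \<in> carrier G" "a \<preceq> b" "b \<preceq> \<one>" for a b
  proof -
    have "b \<preceq> b \<^bold>\<squnion> c" "c \<preceq> b \<^bold>\<squnion> c" using that c by (auto intro: join_ge1 join_ge2)
    moreover from this have "a \<preceq> b \<^bold>\<squnion> c" using that c by (auto intro: ple_trans[of a b])
    ultimately have "a \<^bold>\<squnion> c \<preceq> b \<^bold>\<squnion> c" using that c by (auto intro: join_least)
    then show ?thesis using up[of "a \<^bold>\<squnion> c" b] that by simp
  qed
  ultimately show "convex_neg_submonoid G ?N"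
    unfolding convex_neg_submonoid_def using sub D(1) by auto
qed

text \<open>This \<open>M\<close> corresponds to a value of \<open>u\<close>: it is maximal among
  the convex submonoids missing \<open>u\<close>. Such an \<open>M\<close> is prime. If
  \<open>x\<close> and \<open>y\<close> were outside \<open>M\<close> with join
  \<open>\<one>\<close>, maximality would give first \<open>u \<squnion> y\<close> in
  \<open>M\<close> and then, with \<open>u\<close> in the role of \<open>x \<squnion> y\<close>'s
  second member, \<open>u \<squnion> u\<close> in \<open>M\<close>.\<close>

lemma exists_prime_neg_submonoid:
  assumes u: "u \<in> carrier G" "u \<preceq> \<one>" "u \<noteq> \<one>"
  shows "\<exists>M. convex_neg_submonoid G M \<and> u \<notin> M \<and>
    (\<forall>x\<in>carrier G. \<forall>y\<in>carrier G. x \<preceq> \<one> \<longrightarrow> y \<preceq> \<one> \<longrightarrow> x \<^bold>\<squnion> y = \<one> \<longrightarrow> x \<in> M \<or> y \<in> M)"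
proof -
  define \<S> where "\<S> = {M. convex_neg_submonoid G M \<and> u \<notin> M}"
  have "\<exists>M\<in>\<S>. \<forall>X\<in>\<S>. M \<subseteq> X \<longrightarrow> X = M"
  proof (rule subset_Zorn_nonempty)
    have "convex_neg_submonoid G {\<one>}"
      using ple_antisym[of _ \<one>] ple_refl[of \<one>] by (auto simp: convex_neg_submonoid_def)
    then show "\<S> \<noteq> {}" using u by (auto simp: \<S>_def)
    fix \<C> assume \<C>: "\<C> \<noteq> {}" "subset.chain \<S> \<C>"
    have mem: "convex_neg_submonoid G M" "u \<notin> M" if "M \<in> \<C>" for M
      using \<C>(2) that unfolding subset.chain_def \<S>_def by blast+
    have "x \<otimes> y \<in> \<Union>\<C>" if "x \<in> \<Union>\<C>" "y \<in> \<Union>\<C>" for x y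
    proof -
      have "finite {x, y}" "{x, y} \<subseteq> \<Union>\<C>" using that by auto
      then obtain M where "M \<in> \<C>" "{x, y} \<subseteq> M"
        using \<C> by (rule finite_subset_Union_chain)
      then show ?thesis using convex_neg_submonoidD(4)[OF mem(1)] by blast
    qed
    moreover have "\<one> \<in> \<Union>\<C>" using \<C>(1) convex_neg_submonoidD(1)[OF mem(1)] by blast
    moreover have "x \<in> carrier G \<and> x \<preceq> \<one>" if "x \<in> \<Union>\<C>" for x
      using that convex_neg_submonoidD(2,3)[OF mem(1)] by blast
    moreover have "y \<in> \<Union>\<C>" if "x \<in> \<Union>\<C>" "y \<in> carrier G" "x \<preceq> y" "y \<preceq> \<one>" for x y
      using that convex_neg_submonoidD(5)[OF mem(1)] by blast
    ultimately have "convex_neg_submonoid G (\<Union>\<C>)"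
      unfolding convex_neg_submonoid_def by blast
    then show "\<Union>\<C> \<in> \<S>" using mem(2) by (auto simp: \<S>_def)
  qed
  then obtain M where "M \<in> \<S>" and max: "\<And>X. X \<in> \<S> \<Longrightarrow> M \<subseteq> X \<Longrightarrow> X = M" by blast
  then have M: "convex_neg_submonoid G M" and uM: "u \<notin> M" by (auto simp: \<S>_def)
  \<comment> \<open>The elements whose join with \<open>c\<close> lies in \<open>M\<close> form a
    convex submonoid containing \<open>M\<close>. The element \<open>z\<close> makes it strictly
    larger, so by maximality it cannot miss \<open>u\<close>.\<close>
  have enlarge: "u \<^bold>\<squnion> c \<in> M"
    if "c \<in> carrier G" "c \<preceq> \<one>" "z \<in> carrier G" "z \<preceq> \<one>" "z \<notin> M" "z \<^bold>\<squnion> c \<in> M" for z c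
  proof (rule ccontr)
    assume "u \<^bold>\<squnion> c \<notin> M"
    then have "{z \<in> carrier G. z \<preceq> \<one> \<and> z \<^bold>\<squnion> c \<in> M} = M"
      using convex_neg_submonoid_join[OF M, of c] that by (intro max) (auto simp: \<S>_def)
    then show False using that by blast
  qed
  have comm: "a \<^bold>\<squnion> b = b \<^bold>\<squnion> a" for a b
    by (simp add: Lattice.join_def insert_commute)
  have "x \<in> M \<or> y \<in> M"
    if "x \<in> carrier G" "y \<in> carrier G" "x \<preceq> \<one>" "y \<preceq> \<one>" "x \<^bold>\<squnion> y = \<one>" for x y
  proof (rule ccontr)
    assume no: "\<not> (x \<in> M \<or> y \<in> M)"
    then have "u \<^bold>\<squnion> y \<in> M"
      using enlarge[of y x] that convex_neg_submonoidD(1)[OF M] by simp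
    then have "u \<^bold>\<squnion> u \<in> M"
      using enlarge[of u y] that u no by (simp add: comm)
    then show False using uM u join_absorb1[of u u] by (simp add: ple_refl)
  qed
  then show ?thesis using M uM by blast
qed

text \<open>If \<open>P\<close> is the convex l-subgroup with negative part \<open>M\<close>, the
  elements whose negative part lies in \<open>M\<close> are those that move the coset
  \<open>P\<close> upward in the chain of right cosets. Totality is primeness of \<open>M\<close>
  applied to the orthogonal negative parts of \<open>a\<close> and \<open>inv a\<close>.\<close>

lemma exists_total_cone_notin:
  assumes f: "f \<in> carrier G" "\<not> \<one> \<preceq> f"
  shows "\<exists>C. total_cone G C \<and> f \<notin> C"
proof -
  have "f \<^bold>\<sqinter> \<one> \<noteq> \<one>" using f meet_le1[of f \<one>] by auto
  then obtain M where M: "convex_neg_submonoid G M" "f \<^bold>\<sqinter> \<one> \<notin> M"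
    and prime: "\<And>x y. x \<in> carrier G \<Longrightarrow> y \<in> carrier G \<Longrightarrow> x \<preceq> \<one> \<Longrightarrow> y \<preceq> \<one> \<Longrightarrow> x \<^bold>\<squnion> y = \<one> \<Longrightarrow>
      x \<in> M \<or> y \<in> M"
    using exists_prime_neg_submonoid[of "f \<^bold>\<sqinter> \<one>"] f meet_le2[of f \<one>] by auto
  note D = convex_neg_submonoidD[OF M(1)]
  have "total_cone G {g \<in> carrier G. g \<^bold>\<sqinter> \<one> \<in> M}"
  proof (rule total_coneI)
    fix a assume "a \<in> carrier G" "\<one> \<preceq> a"
    moreover have "\<one> \<preceq> a \<^bold>\<sqinter> \<one>" using calculation by (intro meet_greatest) (auto simp: ple_refl)
    then have "a \<^bold>\<sqinter> \<one> = \<one>" using calculation by (intro ple_antisym) (auto intro: meet_le2)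
    ultimately show "a \<in> {g \<in> carrier G. g \<^bold>\<sqinter> \<one> \<in> M}" using D(1) by simp
  next
    fix a b assume ab: "a \<in> {g \<in> carrier G. g \<^bold>\<sqinter> \<one> \<in> M}" "b \<in> {g \<in> carrier G. g \<^bold>\<sqinter> \<one> \<in> M}"
    have "(a \<^bold>\<sqinter> \<one>) \<otimes> (b \<^bold>\<sqinter> \<one>) \<preceq> (a \<otimes> b) \<^bold>\<sqinter> \<one>"
      using ab mult_mono[of "a \<^bold>\<sqinter> \<one>" a "b \<^bold>\<sqinter> \<one>" b] mult_mono[of "a \<^bold>\<sqinter> \<one>" \<one> "b \<^bold>\<sqinter> \<one>" \<one>]
      by (intro meet_greatest) (auto intro: meet_le1 meet_le2)
    then have "(a \<otimes> b) \<^bold>\<sqinter> \<one> \<in> M"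
      using D(5)[OF D(4)[of "a \<^bold>\<sqinter> \<one>" "b \<^bold>\<sqinter> \<one>"]] ab meet_le2[of "a \<otimes> b" \<one>] by simp
    then show "a \<otimes> b \<in> {g \<in> carrier G. g \<^bold>\<sqinter> \<one> \<in> M}" using ab by simp
  next
    fix a assume "a \<in> carrier G" "a \<notin> {g \<in> carrier G. g \<^bold>\<sqinter> \<one> \<in> M}"
    then show "inv a \<in> {g \<in> carrier G. g \<^bold>\<sqinter> \<one> \<in> M}"
      using prime[of "a \<^bold>\<sqinter> \<one>" "inv a \<^bold>\<sqinter> \<one>"] meet_inv_join[of a] by (auto intro: meet_le2)
  qed auto
  then show ?thesis using M(2) by blast
qed

end

section \<open>Totally ordered factors and subdirect representations\<close>

lemma to_group_total:
  "to_group T \<Longrightarrow> x \<in> carrier T \<Longrightarrow> y \<in> carrier T \<Longrightarrow> x \<preceq>\<^bsub>T\<^esub> y \<or> y \<preceq>\<^bsub>T\<^esub> x"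
  unfolding to_group_def total_order_order_of_iff by blast

lemma to_group_variety_cone:
  fixes T (structure)
  assumes "to_group T"
  shows "variety_cone Representable T {a \<in> carrier T. \<one> \<preceq> a}"
proof -
  interpret po_grp T using assms by (simp add: to_group_def po_grpI)
  show ?thesis
  proof (rule variety_coneI)
    show "total_cone T {a \<in> carrier T. \<one> \<preceq> a}"
    proof (rule total_coneI)
      show "a \<otimes> b \<in> {a \<in> carrier T. \<one> \<preceq> a}"
        if "a \<in> {a \<in> carrier T. \<one> \<preceq> a}" "b \<in> {a \<in> carrier T. \<one> \<preceq> a}" for a b
        using mult_mono[of \<one> a \<one> b] that by simp
      show "inv a \<in> {a \<in> carrier T. \<one> \<preceq> a}"
        if "a \<in> carrier T" "a \<notin> {a \<in> carrier T. \<one> \<preceq> a}" for a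
        using to_group_total[OF assms, of \<one> a] that by (simp add: one_ple_inv_iff)
    qed auto
    show "g \<otimes> a \<otimes> inv g \<in> {a \<in> carrier T. \<one> \<preceq> a}"
      if "g \<in> carrier T" "a \<in> {a \<in> carrier T. \<one> \<preceq> a}" for g a
      using mult_right_mono[of g "g \<otimes> a" "inv g"] mult_left_mono[of \<one> a g] that by simp
  qed simp
qed

lemma l_product_simps [simp]:
  "carrier (l_product I T) = (\<Pi>\<^sub>E i\<in>I. carrier (T i))"
  "x \<otimes>\<^bsub>l_product I T\<^esub> y = (\<lambda>i\<in>I. x i \<otimes>\<^bsub>T i\<^esub> y i)"
  "\<one>\<^bsub>l_product I T\<^esub> = (\<lambda>i\<in>I. \<one>\<^bsub>T i\<^esub>)"
  "x \<preceq>\<^bsub>l_product I T\<^esub> y \<longleftrightarrow> (\<forall>i\<in>I. x i \<preceq>\<^bsub>T i\<^esub> y i)"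
  by (simp_all add: l_product_def)

text \<open>Membership in \<open>l_hom\<close> speaks of joins and meets, and these determine the
  order only if the codomain is an l-group. For the product this is checked coordinatewise.\<close>

lemma l_group_l_product:
  assumes "\<And>i. i \<in> I \<Longrightarrow> l_group (T i)"
  shows "l_group (l_product I T)"
proof -
  have lg: "l_grp (T i)" if "i \<in> I" for i using assms[OF that] by (rule l_grpI)
  note po = l_grp.axioms(1)[OF lg]
  note gr = po_grp.axioms(1)[OF po]
  note mon = group.is_monoid[OF gr]
  have grp: "group (l_product I T)"
  proof (rule groupI)
    fix x assume x: "x \<in> carrier (l_product I T)"
    have "(\<lambda>i\<in>I. inv\<^bsub>T i\<^esub> x i) \<otimes>\<^bsub>l_product I T\<^esub> x = \<one>\<^bsub>l_product I T\<^esub>"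
      using x by (auto simp: fun_eq_iff PiE_iff group.l_inv[OF gr])
    moreover have "(\<lambda>i\<in>I. inv\<^bsub>T i\<^esub> x i) \<in> carrier (l_product I T)"
      using x by (auto simp: PiE_iff group.inv_closed[OF gr])
    ultimately show "\<exists>y\<in>carrier (l_product I T). y \<otimes>\<^bsub>l_product I T\<^esub> x = \<one>\<^bsub>l_product I T\<^esub>"
      by blast
  next
    fix x assume "x \<in> carrier (l_product I T)"
    then show "\<one>\<^bsub>l_product I T\<^esub> \<otimes>\<^bsub>l_product I T\<^esub> x = x"
      by (auto simp: fun_eq_iff PiE_iff extensional_def monoid.l_one[OF mon])
  qed (auto simp: PiE_iff fun_eq_iff monoid.m_closed[OF mon] monoid.m_assoc[OF mon] monoid.one_closed[OF mon])
  have ord: "partial_order (order_of (l_product I T))"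
  proof (rule partial_order_order_ofI)
    fix x y assume xy: "x \<in> carrier (l_product I T)" "y \<in> carrier (l_product I T)"
      "x \<preceq>\<^bsub>l_product I T\<^esub> y" "y \<preceq>\<^bsub>l_product I T\<^esub> x"
    show "x = y"
    proof (rule PiE_ext)
      show "x i = y i" if "i \<in> I" for i
        by (rule po_grp.ple_antisym[OF po[OF that]]) (use xy that in auto)
    qed (use xy in simp_all)
  next
    fix x y z assume xyz: "x \<in> carrier (l_product I T)" "y \<in> carrier (l_product I T)"
      "z \<in> carrier (l_product I T)" "x \<preceq>\<^bsub>l_product I T\<^esub> y" "y \<preceq>\<^bsub>l_product I T\<^esub> z"
    show "x \<preceq>\<^bsub>l_product I T\<^esub> z"
      unfolding l_product_simps
    proof
      show "x i \<preceq>\<^bsub>T i\<^esub> z i" if "i \<in> I" for i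
        by (rule po_grp.ple_trans[OF po[OF that], of _ "y i"]) (use xyz that in auto)
    qed
  qed (auto simp: PiE_iff po_grp.ple_refl[OF po])
  have "po_group (l_product I T)"
    unfolding po_group_def using grp ord by (auto simp: PiE_iff intro: po_grp.mult_both_mono[OF po])
  moreover have "is_join (l_product I T) x y (\<lambda>i\<in>I. x i \<squnion>\<^bsub>order_of (T i)\<^esub> y i)"
    "is_meet (l_product I T) x y (\<lambda>i\<in>I. x i \<sqinter>\<^bsub>order_of (T i)\<^esub> y i)"
    if "x \<in> carrier (l_product I T)" "y \<in> carrier (l_product I T)" for x y
    using that unfolding is_join_def is_meet_def
    by (auto simp: PiE_iff l_grp.join_closed[OF lg] l_grp.join_ge1[OF lg] l_grp.join_ge2[OF lg]
        l_grp.meet_closed[OF lg] l_grp.meet_le1[OF lg] l_grp.meet_le2[OF lg]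
        intro: l_grp.join_least[OF lg] l_grp.meet_greatest[OF lg])
  ultimately show ?thesis
    using ord unfolding l_group_def lattice_order_of_iff by blast
qed

text \<open>An injective l-homomorphism reflects the order, so some coordinate of \<open>f\<close>
  is not positive. The positive cone of that totally ordered factor is normal, and so is its
  preimage.\<close>

lemma representable_variety_cone_notin:
  fixes F (structure)
  assumes "representable F" "f \<in> carrier F" "\<not> \<one> \<preceq> f"
  shows "\<exists>C. variety_cone Representable F C \<and> f \<notin> C"
proof -
  obtain I and T :: "'a set \<Rightarrow> 'a set pogroup" and \<phi> where
    T: "\<And>i. i \<in> I \<Longrightarrow> to_group (T i)" and \<phi>: "\<phi> \<in> l_hom F (l_product I T)"
    and inj: "inj_on \<phi> (carrier F)" and "l_group F"
    using assms(1) unfolding representable_def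
    by (elim conjE exE) (rule that, erule bspec, assumption+)
  interpret l_grp F using \<open>l_group F\<close> by (rule l_grpI)
  have lP: "l_group (l_product I T)"
    by (rule l_group_l_product) (rule to_group_imp_l_group[OF T])
  interpret P: l_grp "l_product I T" using lP by (rule l_grpI)
  have pos: "\<phi> \<in> pos_hom F (l_product I T)"
    by (rule l_hom_imp_pos_hom[OF \<open>l_group F\<close> lP \<phi>])
  then have hom: "\<phi> \<in> hom F (l_product I T)" by (simp add: pos_hom_def)
  have one: "\<phi> \<one> = \<one>\<^bsub>l_product I T\<^esub>"
    by (rule hom_one[OF hom is_group P.is_group])
  have PiE: "\<phi> x \<in> (\<Pi>\<^sub>E i\<in>I. carrier (T i))" if "x \<in> carrier F" for x
    using hom_in_carrier[OF hom that] by simp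
  have "\<not> \<one>\<^bsub>l_product I T\<^esub> \<preceq>\<^bsub>l_product I T\<^esub> \<phi> f"
  proof
    assume "\<one>\<^bsub>l_product I T\<^esub> \<preceq>\<^bsub>l_product I T\<^esub> \<phi> f"
    then have "\<one>\<^bsub>l_product I T\<^esub> \<squnion>\<^bsub>order_of (l_product I T)\<^esub> \<phi> f = \<phi> f"
      by (intro P.join_absorb2 P.one_closed hom_in_carrier[OF hom assms(2)])
    then have "\<phi> (\<one> \<squnion>\<^bsub>order_of F\<^esub> f) = \<phi> f"
      using l_hom_join[OF \<phi> one_closed assms(2)] one by simp
    then have "\<one> \<squnion>\<^bsub>order_of F\<^esub> f = f"
      using inj_onD[OF inj] assms(2) by simp
    then show False using join_ge1[of \<one> f] assms(2,3) by simp
  qed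
  then obtain i where i: "i \<in> I" "\<not> \<one>\<^bsub>T i\<^esub> \<preceq>\<^bsub>T i\<^esub> \<phi> f i" by auto
  have "(\<lambda>x. \<phi> x i) \<in> pos_hom F (T i)"
    using pos i(1) PiE by (simp add: pos_hom_def hom_def Pi_iff PiE_iff)
  moreover have "po_group (T i)" using T[OF i(1)] by (simp add: to_group_def)
  ultimately have "variety_cone Representable F {a \<in> carrier F. \<phi> a i \<in> {a \<in> carrier (T i). \<one>\<^bsub>T i\<^esub> \<preceq>\<^bsub>T i\<^esub> a}}"
    by (rule variety_cone_vimage[OF po_group _ _ to_group_variety_cone[OF T[OF i(1)]], rotated])
  then show ?thesis using i(2) by blast
qed

text \<open>In the Abelian case the cone from Holland's argument serves again: conjugation is
  trivial, and commutators equal the identity, which every cone contains.\<close>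

lemma variety_cone_notin:
  fixes F (structure)
  assumes "in_variety V F" "f \<in> carrier F" "\<not> \<one> \<preceq> f"
  shows "\<exists>C. variety_cone V F C \<and> f \<notin> C"
proof -
  interpret l_grp F using in_variety_imp_l_group[OF assms(1)] by (rule l_grpI)
  obtain C where C: "total_cone F C" "f \<notin> C"
    using exists_total_cone_notin[OF assms(2,3)] by blast
  show ?thesis
  proof (cases V)
    case All
    then show ?thesis using C by (auto simp: variety_cone_def)
  next
    case Representable
    then show ?thesis using representable_variety_cone_notin assms by simp
  next
    case Abelian
    then interpret comm_group F using assms(1) by simp
    have "variety_cone V F C"
    proof (rule variety_coneI)
      note CF = subsetD[OF total_cone_subset[OF C(1)]]
      show "g \<otimes> a \<otimes> inv g \<in> C" if "g \<in> carrier F" "a \<in> C" for g a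
        using that CF[OF that(2)] by (simp add: m_comm[of g a] m_assoc)
      show "a \<otimes> b \<otimes> inv (b \<otimes> a) \<in> C" if "a \<in> carrier F" "b \<in> carrier F" for a b
        using that total_cone_one[OF po_group C(1)] by (simp add: m_comm[of a b])
    qed (rule C(1))
    then show ?thesis using C(2) by blast
  qed
qed

section \<open>Automorphisms of a chain\<close>

text \<open>Inversion reverses the order, so the inverse of a join of inverses is a meet. For
  automorphism groups of chains and their l-subgroups it then suffices to exhibit joins.\<close>

lemma l_groupI_join:
  fixes G (structure)
  assumes "po_group G" "\<And>x y. x \<in> carrier G \<Longrightarrow> y \<in> carrier G \<Longrightarrow> \<exists>z. is_join G x y z"
  shows "l_group G"
proof -
  interpret po_grp G using assms(1) by (rule po_grpI)
  have "\<exists>z. is_meet G x y z" if xy: "x \<in> carrier G" "y \<in> carrier G" for x y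
  proof -
    obtain z where z: "is_join G (inv x) (inv y) z"
      using assms(2)[of "inv x" "inv y"] xy by auto
    then have zG: "z \<in> carrier G" by (simp add: is_join_def)
    have "w \<preceq> inv z" if "w \<in> carrier G" "w \<preceq> x" "w \<preceq> y" for w
    proof -
      have "z \<preceq> inv w" using z that xy inv_antimono unfolding is_join_def by simp
      then show ?thesis using inv_antimono[of z "inv w"] zG that by simp
    qed
    then have "is_meet G x y (inv z)"
      using z zG xy inv_antimono[of "inv x" z] inv_antimono[of "inv y" z]
      by (simp add: is_meet_def is_join_def)
    then show ?thesis ..
  qed
  then show ?thesis
    using assms partial_order unfolding l_group_def lattice_order_of_iff by blast
qed

lemma carrier_Aut_chain:
  "f \<in> carrier (Aut_chain L) \<longleftrightarrow> f \<in> Bij (carrier L) \<and>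
    (\<forall>x\<in>carrier L. \<forall>y\<in>carrier L. x \<sqsubseteq>\<^bsub>L\<^esub> y \<longrightarrow> f x \<sqsubseteq>\<^bsub>L\<^esub> f y)"
  by (simp add: Aut_chain_def)

lemma Aut_chain_simps [simp]:
  "f \<otimes>\<^bsub>Aut_chain L\<^esub> g = compose (carrier L) g f"
  "\<one>\<^bsub>Aut_chain L\<^esub> = (\<lambda>x\<in>carrier L. x)"
  "f \<preceq>\<^bsub>Aut_chain L\<^esub> g \<longleftrightarrow> (\<forall>x\<in>carrier L. f x \<sqsubseteq>\<^bsub>L\<^esub> g x)"
  by (simp_all add: Aut_chain_def)

locale chain = total_order L for L :: "'a gorder" (structure)
begin

lemma Aut_chain_closed: "f \<in> carrier (Aut_chain L) \<Longrightarrow> x \<in> carrier L \<Longrightarrow> f x \<in> carrier L"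
  unfolding carrier_Aut_chain using Bij_imp_funcset by blast

lemma Aut_chain_mono:
  "f \<in> carrier (Aut_chain L) \<Longrightarrow> x \<in> carrier L \<Longrightarrow> y \<in> carrier L \<Longrightarrow> x \<sqsubseteq> y \<Longrightarrow> f x \<sqsubseteq> f y"
  by (simp add: carrier_Aut_chain)

lemma Aut_chain_surj:
  assumes "f \<in> carrier (Aut_chain L)" "y \<in> carrier L"
  shows "\<exists>x\<in>carrier L. f x = y"
proof -
  have "y \<in> f ` carrier L"
    using assms by (simp add: carrier_Aut_chain Bij_def bij_betw_def)
  then show ?thesis by (auto simp: image_iff)
qed

lemma Aut_chain_reflect:
  assumes f: "f \<in> carrier (Aut_chain L)" and xy: "x \<in> carrier L" "y \<in> carrier L" "f x \<sqsubseteq> f y"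
  shows "x \<sqsubseteq> y"
proof (rule ccontr)
  assume no: "\<not> x \<sqsubseteq> y"
  then have "y \<sqsubseteq> x" using total_order_total xy by blast
  then have "f y \<sqsubseteq> f x" using Aut_chain_mono f xy by simp
  then have "f x = f y" using le_antisym[OF xy(3)] Aut_chain_closed f xy by simp
  then have "x = y"
    using f xy unfolding carrier_Aut_chain Bij_def bij_betw_def inj_on_def by blast
  then show False using no xy by simp
qed

lemma Aut_chainI:
  assumes "f \<in> extensional (carrier L)" and cl: "\<And>x. x \<in> carrier L \<Longrightarrow> f x \<in> carrier L"
    and mono: "\<And>x y. x \<in> carrier L \<Longrightarrow> y \<in> carrier L \<Longrightarrow> x \<sqsubseteq> y \<Longrightarrow> f x \<sqsubseteq> f y"
    and refl: "\<And>x y. x \<in> carrier L \<Longrightarrow> y \<in> carrier L \<Longrightarrow> f x \<sqsubseteq> f y \<Longrightarrow> x \<sqsubseteq> y"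
    and surj: "\<And>y. y \<in> carrier L \<Longrightarrow> \<exists>x\<in>carrier L. f x = y"
  shows "f \<in> carrier (Aut_chain L)"
proof -
  have "inj_on f (carrier L)"
  proof (rule inj_onI)
    fix x y assume xy: "x \<in> carrier L" "y \<in> carrier L" "f x = f y"
    then have "x \<sqsubseteq> y" "y \<sqsubseteq> x" using refl[of x y] refl[of y x] cl by auto
    then show "x = y" using le_antisym xy by blast
  qed
  moreover have "f ` carrier L = carrier L" using cl surj by force
  ultimately show ?thesis
    using assms(1) mono by (simp add: carrier_Aut_chain Bij_def bij_betw_def)
qed

lemma group_Aut_chain: "group (Aut_chain L)"
proof (rule groupI)
  fix f g assume f: "f \<in> carrier (Aut_chain L)" and g: "g \<in> carrier (Aut_chain L)"
  have "compose (carrier L) g f \<in> Bij (carrier L)"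
    using f g by (intro compose_Bij) (simp_all add: carrier_Aut_chain)
  then show "f \<otimes>\<^bsub>Aut_chain L\<^esub> g \<in> carrier (Aut_chain L)"
    using f g unfolding carrier_Aut_chain
    by (auto simp: compose_def Aut_chain_closed[OF f] Aut_chain_mono[OF g] Aut_chain_mono[OF f])
next
  show "\<one>\<^bsub>Aut_chain L\<^esub> \<in> carrier (Aut_chain L)"
    by (simp add: carrier_Aut_chain id_Bij)
next
  fix f g h assume "f \<in> carrier (Aut_chain L)" "g \<in> carrier (Aut_chain L)" "h \<in> carrier (Aut_chain L)"
  then show "f \<otimes>\<^bsub>Aut_chain L\<^esub> g \<otimes>\<^bsub>Aut_chain L\<^esub> h = f \<otimes>\<^bsub>Aut_chain L\<^esub> (g \<otimes>\<^bsub>Aut_chain L\<^esub> h)"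
    by (auto simp: compose_def fun_eq_iff Aut_chain_closed)
next
  fix f assume "f \<in> carrier (Aut_chain L)"
  then show "\<one>\<^bsub>Aut_chain L\<^esub> \<otimes>\<^bsub>Aut_chain L\<^esub> f = f"
    by (auto simp: carrier_Aut_chain Bij_def compose_def fun_eq_iff extensional_def)
next
  fix f assume f: "f \<in> carrier (Aut_chain L)"
  then have fB: "f \<in> Bij (carrier L)" by (simp add: carrier_Aut_chain)
  let ?g = "restrict (inv_into (carrier L) f) (carrier L)"
  have g: "?g \<in> Bij (carrier L)" by (rule restrict_inv_into_Bij[OF fB])
  have im: "f ` carrier L = carrier L" using fB by (simp add: Bij_def bij_betw_def)
  have cl: "inv_into (carrier L) f x \<in> carrier L" and fg: "f (inv_into (carrier L) f x) = x"
    if "x \<in> carrier L" for x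
    using that im by (simp_all add: inv_into_into f_inv_into_f)
  have "?g \<in> carrier (Aut_chain L)"
    unfolding carrier_Aut_chain
    using g by (auto simp: cl fg intro: Aut_chain_reflect[OF f])
  moreover have "?g \<otimes>\<^bsub>Aut_chain L\<^esub> f = \<one>\<^bsub>Aut_chain L\<^esub>"
    by (auto simp: compose_def fun_eq_iff fg)
  ultimately show "\<exists>g\<in>carrier (Aut_chain L). g \<otimes>\<^bsub>Aut_chain L\<^esub> f = \<one>\<^bsub>Aut_chain L\<^esub>"
    by blast
qed

lemma po_group_Aut_chain: "po_group (Aut_chain L)"
proof -
  have "partial_order (order_of (Aut_chain L))"
  proof (rule partial_order_order_ofI)
    fix f g assume fg: "f \<in> carrier (Aut_chain L)" "g \<in> carrier (Aut_chain L)"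
      "f \<preceq>\<^bsub>Aut_chain L\<^esub> g" "g \<preceq>\<^bsub>Aut_chain L\<^esub> f"
    show "f = g"
    proof (rule extensionalityI)
      show "f x = g x" if "x \<in> carrier L" for x
        by (rule le_antisym) (use fg that in \<open>auto intro: Aut_chain_closed\<close>)
    qed (use fg in \<open>auto simp: carrier_Aut_chain Bij_def\<close>)
  next
    fix f g h assume fgh: "f \<in> carrier (Aut_chain L)" "g \<in> carrier (Aut_chain L)"
      "h \<in> carrier (Aut_chain L)" "f \<preceq>\<^bsub>Aut_chain L\<^esub> g" "g \<preceq>\<^bsub>Aut_chain L\<^esub> h"
    show "f \<preceq>\<^bsub>Aut_chain L\<^esub> h"
      unfolding Aut_chain_simps
    proof
      show "f x \<sqsubseteq> h x" if "x \<in> carrier L" for x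
        by (rule le_trans[of _ "g x"]) (use fgh that in \<open>auto intro: Aut_chain_closed\<close>)
    qed
  qed (auto intro: Aut_chain_closed)
  moreover have "s \<otimes>\<^bsub>Aut_chain L\<^esub> f \<otimes>\<^bsub>Aut_chain L\<^esub> t \<preceq>\<^bsub>Aut_chain L\<^esub> s \<otimes>\<^bsub>Aut_chain L\<^esub> g \<otimes>\<^bsub>Aut_chain L\<^esub> t"
    if fgst: "f \<in> carrier (Aut_chain L)" "g \<in> carrier (Aut_chain L)" "s \<in> carrier (Aut_chain L)"
      "t \<in> carrier (Aut_chain L)" and le: "f \<preceq>\<^bsub>Aut_chain L\<^esub> g" for f g s t
    unfolding Aut_chain_simps
  proof
    fix x assume x: "x \<in> carrier L"
    then have sx: "s x \<in> carrier L" using fgst(3) by (rule Aut_chain_closed[rotated])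
    then have "t (f (s x)) \<sqsubseteq> t (g (s x))"
      using le by (intro Aut_chain_mono[OF fgst(4)] Aut_chain_closed[OF fgst(1)] Aut_chain_closed[OF fgst(2)]) simp_all
    then show "compose (carrier L) t (compose (carrier L) f s) x
        \<sqsubseteq> compose (carrier L) t (compose (carrier L) g s) x"
      using x by (simp add: compose_def)
  qed
  ultimately show ?thesis
    unfolding po_group_def using group_Aut_chain by blast
qed

text \<open>The pointwise maximum reflects the order because its value at \<open>y\<close> is
  \<open>f y\<close> or \<open>g y\<close>, while its value at \<open>x\<close> dominates both
  \<open>f x\<close> and \<open>g x\<close>; so one of the two automorphisms compares
  \<open>x\<close> with \<open>y\<close>.\<close>

lemma is_join_Aut_chain:
  assumes f: "f \<in> carrier (Aut_chain L)" and g: "g \<in> carrier (Aut_chain L)"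
  shows "is_join (Aut_chain L) f g (\<lambda>x\<in>carrier L. if f x \<sqsubseteq> g x then g x else f x)"
    (is "is_join _ f g ?h")
proof -
  have fx [simp]: "f x \<in> carrier L" and gx [simp]: "g x \<in> carrier L" if "x \<in> carrier L" for x
    using that f g by (auto intro: Aut_chain_closed)
  have ge: "f x \<sqsubseteq> ?h x" "g x \<sqsubseteq> ?h x" and eq: "?h x = f x \<or> ?h x = g x" and hx: "?h x \<in> carrier L"
    if "x \<in> carrier L" for x
    using that total_order_total[of "f x" "g x"] by auto
  have "?h \<in> carrier (Aut_chain L)"
  proof (rule Aut_chainI)
    fix x y assume xy: "x \<in> carrier L" "y \<in> carrier L" "x \<sqsubseteq> y"
    have "f x \<sqsubseteq> ?h y" "g x \<sqsubseteq> ?h y"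
      using le_trans[OF Aut_chain_mono[OF f xy] ge(1)[OF xy(2)]]
        le_trans[OF Aut_chain_mono[OF g xy] ge(2)[OF xy(2)]] xy(1,2) hx[OF xy(2)] fx gx by simp_all
    then show "?h x \<sqsubseteq> ?h y" using eq[OF xy(1)] by metis
  next
    fix x y assume xy: "x \<in> carrier L" "y \<in> carrier L" "?h x \<sqsubseteq> ?h y"
    then have "f x \<sqsubseteq> ?h y" "g x \<sqsubseteq> ?h y"
      using le_trans[OF ge(1)[OF xy(1)] xy(3)] le_trans[OF ge(2)[OF xy(1)] xy(3)]
        hx[OF xy(1)] hx[OF xy(2)] fx gx by blast+
    then have "f x \<sqsubseteq> f y \<or> g x \<sqsubseteq> g y" using eq[OF xy(2)] by metis
    then show "x \<sqsubseteq> y" using Aut_chain_reflect f g xy by blast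
  next
    fix y assume y: "y \<in> carrier L"
    obtain a where a: "a \<in> carrier L" "f a = y" using Aut_chain_surj[OF f y] by blast
    obtain b where b: "b \<in> carrier L" "g b = y" using Aut_chain_surj[OF g y] by blast
    \<comment> \<open>The preimage of \<open>y\<close> under the maximum is the smaller of its
      preimages under \<open>f\<close> and \<open>g\<close>: there one map takes the value
      \<open>y\<close>, and the other does not exceed it.\<close>
    have "?h a = y" if "a \<sqsubseteq> b"
    proof (rule le_antisym)
      have "g a \<sqsubseteq> y" using Aut_chain_mono[OF g a(1) b(1) that] b by simp
      then show "?h a \<sqsubseteq> y" using eq[OF a(1)] a y by auto
      show "y \<sqsubseteq> ?h a" using ge(1)[OF a(1)] a(2) by simp
    qed (use a y hx in auto)
    moreover have "?h b = y" if "b \<sqsubseteq> a"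
    proof (rule le_antisym)
      have "f b \<sqsubseteq> y" using Aut_chain_mono[OF f b(1) a(1) that] a by simp
      then show "?h b \<sqsubseteq> y" using eq[OF b(1)] b y by auto
      show "y \<sqsubseteq> ?h b" using ge(2)[OF b(1)] b(2) by simp
    qed (use b y hx in auto)
    ultimately show "\<exists>x\<in>carrier L. ?h x = y" using total_order_total[of a b] a(1) b(1) by blast
  qed (use hx in auto)
  then show ?thesis using ge by (simp add: is_join_def)
qed

lemma l_group_Aut_chain: "l_group (Aut_chain L)"
  using l_groupI_join[OF po_group_Aut_chain] is_join_Aut_chain by blast

lemma join_Aut_chain:
  assumes "f \<in> carrier (Aut_chain L)" "g \<in> carrier (Aut_chain L)" "x \<in> carrier L"
  shows "(f \<squnion>\<^bsub>order_of (Aut_chain L)\<^esub> g) x = (if f x \<sqsubseteq> g x then g x else f x)"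
proof -
  have "f \<squnion>\<^bsub>order_of (Aut_chain L)\<^esub> g = (\<lambda>x\<in>carrier L. if f x \<sqsubseteq> g x then g x else f x)"
    by (rule join_eqI[OF po_grp.partial_order[OF po_grpI[OF po_group_Aut_chain]] assms(1,2)
          is_join_Aut_chain[OF assms(1,2)]])
  then show ?thesis using assms(3) by simp
qed

end

section \<open>Sublattice subgroups\<close>

text \<open>Joins in the l-subgroup are selected by \<open>SOME\<close> from a smaller carrier, so
  their agreement with the ambient joins has to be derived. It makes the pointwise description of
  joins available in \<open>H_grp\<close>.\<close>

lemma l_subgroup_l_group:
  assumes "l_group A" "l_subgroup S A"
  shows "l_group (A\<lparr>carrier := S\<rparr>)"
    and "x \<in> S \<Longrightarrow> y \<in> S \<Longrightarrow>
      x \<squnion>\<^bsub>order_of (A\<lparr>carrier := S\<rparr>)\<^esub> y = x \<squnion>\<^bsub>order_of A\<^esub> y"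
proof -
  interpret A: l_grp A using assms(1) by (rule l_grpI)
  have sub: "subgroup S A" and cl: "x \<in> S \<Longrightarrow> y \<in> S \<Longrightarrow> x \<squnion>\<^bsub>order_of A\<^esub> y \<in> S" for x y
    using assms(2) by (simp_all add: l_subgroup_def)
  note SA = subsetD[OF subgroup.subset[OF sub]]
  have po: "partial_order (order_of (A\<lparr>carrier := S\<rparr>))"
  proof (rule partial_order_order_ofI)
    fix x y z assume "x \<in> carrier (A\<lparr>carrier := S\<rparr>)" "y \<in> carrier (A\<lparr>carrier := S\<rparr>)"
      "z \<in> carrier (A\<lparr>carrier := S\<rparr>)" "x \<preceq>\<^bsub>A\<lparr>carrier := S\<rparr>\<^esub> y" "y \<preceq>\<^bsub>A\<lparr>carrier := S\<rparr>\<^esub> z"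
    then show "x \<preceq>\<^bsub>A\<lparr>carrier := S\<rparr>\<^esub> z" using A.ple_trans[of x y z] SA by simp
  qed (auto simp: SA intro: A.ple_refl A.ple_antisym)
  have "po_group (A\<lparr>carrier := S\<rparr>)"
    unfolding po_group_def using po A.subgroup_imp_group[OF sub]
    by (auto simp: SA intro: A.mult_both_mono)
  moreover have join: "is_join (A\<lparr>carrier := S\<rparr>) x y (x \<squnion>\<^bsub>order_of A\<^esub> y)" if "x \<in> S" "y \<in> S" for x y
    using A.is_join_join[of x y] cl[OF that] that SA by (simp add: is_join_def)
  ultimately show "l_group (A\<lparr>carrier := S\<rparr>)"
    using l_groupI_join by fastforce
  show "x \<squnion>\<^bsub>order_of (A\<lparr>carrier := S\<rparr>)\<^esub> y = x \<squnion>\<^bsub>order_of A\<^esub> y" if "x \<in> S" "y \<in> S"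
    using join_eqI[OF po _ _ join[OF that]] that by simp
qed

lemma l_subgroup_l_generate:
  assumes "l_group A" "X \<subseteq> carrier A"
  shows "l_subgroup (l_generate A X) A" and "X \<subseteq> l_generate A X"
proof -
  interpret A: l_grp A using assms(1) by (rule l_grpI)
  have "l_subgroup (carrier A) A"
    using A.subgroup_self by (simp add: l_subgroup_def)
  then have "{S. l_subgroup S A \<and> X \<subseteq> S} \<noteq> {}" using assms(2) by blast
  then have "subgroup (l_generate A X) A"
    unfolding l_generate_def by (intro A.subgroups_Inter) (auto simp: l_subgroup_def)
  then show "l_subgroup (l_generate A X) A"
    by (auto simp: l_subgroup_def l_generate_def)
  show "X \<subseteq> l_generate A X" by (auto simp: l_generate_def)
qed

lemma l_generate_least: "l_subgroup S A \<Longrightarrow> X \<subseteq> S \<Longrightarrow> l_generate A X \<subseteq> S"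
  by (auto simp: l_generate_def)

lemma order_iso_imp_l_hom:
  assumes "l_group G" "partial_order (order_of H)" "h \<in> hom G H" "h ` carrier G = carrier H"
    and ord: "\<And>a b. a \<in> carrier G \<Longrightarrow> b \<in> carrier G \<Longrightarrow> h a \<preceq>\<^bsub>H\<^esub> h b \<longleftrightarrow> a \<preceq>\<^bsub>G\<^esub> b"
  shows "h \<in> l_hom G H"
proof -
  interpret l_grp G using assms(1) by (rule l_grpI)
  have hc: "h a \<in> carrier H" if "a \<in> carrier G" for a using that assms(4) by blast
  have "h (a \<squnion>\<^bsub>order_of G\<^esub> b) = h a \<squnion>\<^bsub>order_of H\<^esub> h b"
    "h (a \<sqinter>\<^bsub>order_of G\<^esub> b) = h a \<sqinter>\<^bsub>order_of H\<^esub> h b"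
    if ab: "a \<in> carrier G" "b \<in> carrier G" for a b
  proof -
    have "is_join H (h a) (h b) (h (a \<squnion>\<^bsub>order_of G\<^esub> b))"
      using is_join_join[OF ab] ab unfolding is_join_def assms(4)[symmetric] by (simp add: ord)
    moreover have "is_meet H (h a) (h b) (h (a \<sqinter>\<^bsub>order_of G\<^esub> b))"
      using is_meet_meet[OF ab] ab unfolding is_meet_def assms(4)[symmetric] by (simp add: ord)
    ultimately show "h (a \<squnion>\<^bsub>order_of G\<^esub> b) = h a \<squnion>\<^bsub>order_of H\<^esub> h b"
      "h (a \<sqinter>\<^bsub>order_of G\<^esub> b) = h a \<sqinter>\<^bsub>order_of H\<^esub> h b"
      using join_eqI[OF assms(2) hc hc] meet_eqI[OF assms(2) hc hc] ab by simp_all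
  qed
  then show ?thesis using assms(3) by (simp add: l_hom_def)
qed

text \<open>A single factor suffices. As the factors in \<open>representable\<close> live on sets of
  elements, \<open>G\<close> is copied onto its singletons, with \<open>the_elem\<close> undoing the
  copying; the index \<open>{}\<close> is an arbitrary choice.\<close>

lemma to_group_imp_representable:
  assumes "to_group G"
  shows "representable G"
proof -
  have lG: "l_group G" using assms by (rule to_group_imp_l_group)
  interpret l_grp G using lG by (rule l_grpI)
  define T :: "'a set pogroup" where "T = \<lparr>carrier = (\<lambda>x. {x}) ` carrier G,
    monoid.mult = (\<lambda>X Y. {the_elem X \<otimes>\<^bsub>G\<^esub> the_elem Y}), one = {\<one>\<^bsub>G\<^esub>},
    ple = (\<lambda>X Y. the_elem X \<preceq>\<^bsub>G\<^esub> the_elem Y)\<rparr>"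
  have T [simp]: "carrier T = (\<lambda>x. {x}) ` carrier G" "\<one>\<^bsub>T\<^esub> = {\<one>\<^bsub>G\<^esub>}"
    "{x} \<otimes>\<^bsub>T\<^esub> {y} = {x \<otimes>\<^bsub>G\<^esub> y}" "{x} \<preceq>\<^bsub>T\<^esub> {y} \<longleftrightarrow> x \<preceq>\<^bsub>G\<^esub> y" for x y
    by (simp_all add: T_def)
  have grp: "group T"
  proof (rule groupI)
    fix X assume "X \<in> carrier T"
    then obtain x where x: "X = {x}" "x \<in> carrier G" by auto
    then show "\<exists>Y\<in>carrier T. Y \<otimes>\<^bsub>T\<^esub> X = \<one>\<^bsub>T\<^esub>"
      by (intro bexI[of _ "{inv\<^bsub>G\<^esub> x}"]) auto
  qed (auto simp: m_assoc)
  have ord: "partial_order (order_of T)"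
    by (rule partial_order_order_ofI) (auto intro: ple_refl ple_antisym ple_trans[rotated 3])
  have "po_group T"
    unfolding po_group_def using grp ord by (auto intro: mult_both_mono)
  then have toT: "to_group T"
    unfolding to_group_def total_order_order_of_iff
    using ord to_group_total[OF assms] by auto
  have lP: "l_group (l_product {{}} (\<lambda>_ :: 'a set. T))"
    by (rule l_group_l_product) (rule to_group_imp_l_group[OF toT])
  let ?\<phi> = "\<lambda>x. \<lambda>i\<in>{{} :: 'a set}. {x}"
  have "?\<phi> \<in> l_hom G (l_product {{}} (\<lambda>_. T))"
  proof (rule order_iso_imp_l_hom[OF lG])
    show "partial_order (order_of (l_product {{}} (\<lambda>_ :: 'a set. T)))"
      using lP by (simp add: l_group_def po_group_def)
    show "?\<phi> \<in> hom G (l_product {{}} (\<lambda>_. T))"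
      by (auto simp: hom_def fun_eq_iff)
    show "?\<phi> ` carrier G = carrier (l_product {{}} (\<lambda>_. T))"
    proof
      show "carrier (l_product {{}} (\<lambda>_. T)) \<subseteq> ?\<phi> ` carrier G"
      proof
        fix f assume f: "f \<in> carrier (l_product {{}} (\<lambda>_ :: 'a set. T))"
        then have "f {} \<in> (\<lambda>x. {x}) ` carrier G" by (auto simp: PiE_iff)
        then obtain x where "x \<in> carrier G" "f {} = {x}" by blast
        moreover have "f = ?\<phi> x"
          using f \<open>f {} = {x}\<close> by (auto simp: fun_eq_iff PiE_iff extensional_def)
        ultimately show "f \<in> ?\<phi> ` carrier G" by blast
      qed
    qed (rule image_subsetI, simp)
  qed simp
  moreover have "inj_on ?\<phi> (carrier G)"
    by (rule inj_onI, drule fun_cong[of _ _ "{}"]) simp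
  ultimately show ?thesis
    unfolding representable_def using lG toT
    by (intro conjI exI[of _ "{{}}"] exI[of _ "\<lambda>_. T"] exI[of _ ?\<phi>]) auto
qed

section \<open>Pre-cones\<close>

lemma precone_rel_iff:
  "(a, b) \<in> precone_rel G C \<longleftrightarrow> a \<in> carrier G \<and> b \<in> carrier G \<and> b \<otimes>\<^bsub>G\<^esub> inv\<^bsub>G\<^esub> a \<in> C"
  by (simp add: precone_rel_def)

locale cone_grp = po_grp G for G :: "'a pogroup" (structure) +
  fixes C
  assumes cone: "total_cone G C"
begin

lemma cone_carrier: "a \<in> C \<Longrightarrow> a \<in> carrier G"
  using total_cone_subset[OF cone] by blast

lemma one_cone: "\<one> \<in> C"
  by (rule total_cone_one[OF po_group cone])

lemma precone_rel_refl: "a \<in> carrier G \<Longrightarrow> (a, a) \<in> precone_rel G C"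
  by (simp add: precone_rel_iff one_cone)

lemma precone_rel_trans:
  assumes "(a, b) \<in> precone_rel G C" "(b, c) \<in> precone_rel G C"
  shows "(a, c) \<in> precone_rel G C"
proof -
  have abc: "a \<in> carrier G" "b \<in> carrier G" "c \<in> carrier G"
    using assms by (auto simp: precone_rel_iff)
  have "(c \<otimes> inv b) \<otimes> (b \<otimes> inv a) \<in> C"
    using total_cone_mult[OF cone] assms by (simp add: precone_rel_iff)
  then show ?thesis using abc by (simp add: precone_rel_iff m_assoc mult_inv_cancel)
qed

lemma precone_rel_total:
  assumes "a \<in> carrier G" "b \<in> carrier G"
  shows "(a, b) \<in> precone_rel G C \<or> (b, a) \<in> precone_rel G C"
  using total_cone_total[OF cone, of "b \<otimes> inv a"] assms by (auto simp: precone_rel_iff inv_mult_group)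

lemma precone_rel_right:
  assumes "(a, b) \<in> precone_rel G C" "t \<in> carrier G"
  shows "(a \<otimes> t, b \<otimes> t) \<in> precone_rel G C"
proof -
  have ab: "a \<in> carrier G" "b \<in> carrier G" using assms by (auto simp: precone_rel_iff)
  then show ?thesis
    using assms by (simp add: precone_rel_iff inv_mult_group m_assoc mult_inv_cancel)
qed

lemma precone_rel_cancel_right:
  assumes "a \<in> carrier G" "b \<in> carrier G" "t \<in> carrier G"
  shows "(a \<otimes> t, b \<otimes> t) \<in> precone_rel G C \<longleftrightarrow> (a, b) \<in> precone_rel G C"
  using precone_rel_right[of "a \<otimes> t" "b \<otimes> t" "inv t"] precone_rel_right[of a b t] assms
  by (auto simp: m_assoc)

lemma right_preorder_precone_rel:
  assumes "C \<noteq> carrier G"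
  shows "right_preorder G (precone_rel G C)"
  unfolding right_preorder_def
proof (intro conjI ballI allI impI)
  have "trans (precone_rel G C)"
    using precone_rel_trans by (rule transI)
  then show "preorder_on (carrier G) (precone_rel G C)"
    by (simp add: preorder_on_def refl_on_def precone_rel_refl precone_rel_def subset_iff one_cone)
  show "total_on (carrier G) (precone_rel G C)"
    using precone_rel_total by (simp add: total_on_def)
  obtain a where "a \<in> carrier G" "a \<notin> C" using assms cone_carrier by blast
  then have "(\<one>, a) \<notin> precone_rel G C" by (simp add: precone_rel_iff)
  then show "precone_rel G C \<noteq> carrier G \<times> carrier G" using \<open>a \<in> carrier G\<close> by blast
  show "(a, b) \<in> precone_rel G C" if "a \<in> carrier G" "b \<in> carrier G" "a \<preceq> b" for a b
    using total_cone_pos[OF cone, of "b \<otimes> inv a"] that ple_iff_one_ple[OF that(1,2)]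
    by (simp add: precone_rel_iff)
qed (rule precone_rel_right)

lemma cone_of_precone_rel: "cone_of G (precone_rel G C) = C"
  using cone_carrier by (auto simp: cone_of_def precone_rel_iff)

end

lemma cone_grpI: "po_group G \<Longrightarrow> total_cone G C \<Longrightarrow> cone_grp G C"
  by (simp add: cone_grp_def cone_grp_axioms_def po_grpI)

lemma total_cone_cone_of:
  fixes G (structure)
  assumes "po_group G" "right_preorder G r"
  shows "total_cone G (cone_of G r)" "cone_of G r \<noteq> carrier G"
proof -
  interpret po_grp G using assms(1) by (rule po_grpI)
  have r: "trans r" "total_on (carrier G) r" "r \<noteq> carrier G \<times> carrier G"
    "\<And>a b. a \<in> carrier G \<Longrightarrow> b \<in> carrier G \<Longrightarrow> a \<preceq> b \<Longrightarrow> (a, b) \<in> r"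
    "\<And>a b t. t \<in> carrier G \<Longrightarrow> (a, b) \<in> r \<Longrightarrow> (a \<otimes> t, b \<otimes> t) \<in> r"
    using assms(2) by (simp_all add: right_preorder_def preorder_on_def)
  show "total_cone G (cone_of G r)"
  proof (rule total_coneI)
    show "a \<otimes> b \<in> cone_of G r" if "a \<in> cone_of G r" "b \<in> cone_of G r" for a b
      using r(5)[of b \<one> a] transD[OF r(1), of \<one> b "a \<otimes> b"] that by (simp add: cone_of_def)
    show "inv a \<in> cone_of G r" if "a \<in> carrier G" "a \<notin> cone_of G r" for a
    proof -
      have "a \<noteq> \<one>" using that r(4)[of \<one> \<one>] ple_refl[of \<one>] by (auto simp: cone_of_def)
      then have "(a, \<one>) \<in> r"
        using r(2) that unfolding total_on_def cone_of_def by blast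
      then show ?thesis using r(5)[of "inv a" a \<one>] that by (simp add: cone_of_def)
    qed
  qed (auto simp: cone_of_def r(4))
  show "cone_of G r \<noteq> carrier G"
  proof
    assume "cone_of G r = carrier G"
    then have "precone_rel G (cone_of G r) = carrier G \<times> carrier G"
      by (auto simp: precone_rel_def)
    then show False using precone_rel_cone_of[OF assms] r(3) by simp
  qed
qed

lemma precones_iff:
  assumes "po_group G"
  shows "C \<in> precones G \<longleftrightarrow> total_cone G C \<and> C \<noteq> carrier G"
proof
  assume "C \<in> precones G"
  then show "total_cone G C \<and> C \<noteq> carrier G"
    using total_cone_cone_of[OF assms] unfolding precones_def by blast
next
  assume C: "total_cone G C \<and> C \<noteq> carrier G"
  then interpret cone_grp G C using assms by (simp add: cone_grpI)
  have "right_preorder G (precone_rel G C)" using C by (simp add: right_preorder_precone_rel)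
  then show "C \<in> precones G"
    unfolding precones_def using cone_of_precone_rel by (intro image_eqI[of _ _ "precone_rel G C"]) simp_all
qed

section \<open>The lattice-ordered group of a pre-cone\<close>

context cone_grp
begin

text \<open>This is the right coset of \<open>b\<close> modulo the subgroup of all \<open>a\<close>
  with \<open>a\<close> and \<open>inv a\<close> in \<open>C\<close>.\<close>

abbreviation cls :: "'a \<Rightarrow> 'a set" where
  "cls b \<equiv> precone_equiv G C `` {b}"

lemma precone_equiv_iff:
  "(a, b) \<in> precone_equiv G C \<longleftrightarrow> (a, b) \<in> precone_rel G C \<and> (b, a) \<in> precone_rel G C"
  by (auto simp: precone_equiv_def)

lemma equiv_precone_equiv: "equiv (carrier G) (precone_equiv G C)"
proof (rule equivI)
  show "precone_equiv G C \<subseteq> carrier G \<times> carrier G"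
    by (auto simp: precone_equiv_iff precone_rel_iff)
  show "refl_on (carrier G) (precone_equiv G C)"
    by (rule refl_onI) (simp add: precone_equiv_iff precone_rel_refl)
  show "sym (precone_equiv G C)" by (rule symI) (simp add: precone_equiv_iff)
  show "trans (precone_equiv G C)"
  proof (rule transI)
    fix a b c assume "(a, b) \<in> precone_equiv G C" "(b, c) \<in> precone_equiv G C"
    then show "(a, c) \<in> precone_equiv G C"
      using precone_rel_trans[of a b c] precone_rel_trans[of c b a] by (simp add: precone_equiv_iff)
  qed
qed

lemma cls_eq_iff:
  "a \<in> carrier G \<Longrightarrow> b \<in> carrier G \<Longrightarrow>
    cls a = cls b \<longleftrightarrow> (a, b) \<in> precone_rel G C \<and> (b, a) \<in> precone_rel G C"
  using eq_equiv_class_iff[OF equiv_precone_equiv, of a b] by (simp add: precone_equiv_iff)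

lemma mem_cls: "a \<in> carrier G \<Longrightarrow> a \<in> cls a"
  by (simp add: precone_equiv_iff precone_rel_refl)

lemma carrier_Omega: "carrier (Omega G C) = cls ` carrier G"
  by (auto simp: Omega_def quotient_def)

lemma le_Omega:
  assumes "a \<in> carrier G" "b \<in> carrier G"
  shows "cls a \<sqsubseteq>\<^bsub>Omega G C\<^esub> cls b \<longleftrightarrow> (a, b) \<in> precone_rel G C"
proof
  assume "cls a \<sqsubseteq>\<^bsub>Omega G C\<^esub> cls b"
  then obtain x y where "x \<in> cls a" "y \<in> cls b" "(x, y) \<in> precone_rel G C"
    unfolding Omega_def by auto
  then show "(a, b) \<in> precone_rel G C"
    using precone_rel_trans[of a x y] precone_rel_trans[of a y b] by (simp add: precone_equiv_iff)
next
  assume "(a, b) \<in> precone_rel G C"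
  then show "cls a \<sqsubseteq>\<^bsub>Omega G C\<^esub> cls b"
    using mem_cls assms unfolding Omega_def by auto
qed

lemma chain_Omega: "chain (Omega G C)"
proof -
  have eq: "eq (Omega G C) = (=)" by (simp add: Omega_def)
  show ?thesis
  proof (unfold_locales, unfold eq)
    fix X assume "X \<in> carrier (Omega G C)"
    then show "X \<sqsubseteq>\<^bsub>Omega G C\<^esub> X"
      by (auto simp del: Image_singleton_iff simp: carrier_Omega le_Omega precone_rel_refl)
  next
    fix X Y assume le: "X \<sqsubseteq>\<^bsub>Omega G C\<^esub> Y" "Y \<sqsubseteq>\<^bsub>Omega G C\<^esub> X"
      and "X \<in> carrier (Omega G C)" "Y \<in> carrier (Omega G C)"
    then obtain a b where "X = cls a" "Y = cls b" "a \<in> carrier G" "b \<in> carrier G"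
      unfolding carrier_Omega by blast
    then show "X = Y" using le by (simp add: le_Omega cls_eq_iff)
  next
    fix X Y Z assume le: "X \<sqsubseteq>\<^bsub>Omega G C\<^esub> Y" "Y \<sqsubseteq>\<^bsub>Omega G C\<^esub> Z"
      and "X \<in> carrier (Omega G C)" "Y \<in> carrier (Omega G C)" "Z \<in> carrier (Omega G C)"
    then obtain a b c where "X = cls a" "Y = cls b" "Z = cls c"
      "a \<in> carrier G" "b \<in> carrier G" "c \<in> carrier G"
      unfolding carrier_Omega by blast
    then show "X \<sqsubseteq>\<^bsub>Omega G C\<^esub> Z" using le precone_rel_trans[of a b c] by (simp add: le_Omega)
  next
    fix X Y assume "X \<in> carrier (Omega G C)" "Y \<in> carrier (Omega G C)"
    then obtain a b where "X = cls a" "Y = cls b" "a \<in> carrier G" "b \<in> carrier G"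
      unfolding carrier_Omega by blast
    then show "X \<sqsubseteq>\<^bsub>Omega G C\<^esub> Y \<or> Y \<sqsubseteq>\<^bsub>Omega G C\<^esub> X"
      using precone_rel_total by (simp add: le_Omega)
  qed auto
qed

text \<open>\<open>R_map\<close> takes a union over all representatives to avoid choosing one. By
  right invariance all members of that union coincide.\<close>

lemma R_map_cls:
  assumes "a \<in> carrier G" "b \<in> carrier G"
  shows "R_map G C a (cls b) = cls (b \<otimes> a)"
proof -
  have "cls (x \<otimes> a) = cls (b \<otimes> a)" if "x \<in> cls b" for x
  proof -
    have x: "x \<in> carrier G" using that by (simp add: precone_equiv_iff precone_rel_iff)
    show ?thesis
      using that x assms by (simp add: cls_eq_iff precone_rel_cancel_right precone_equiv_iff)
  qed
  then have "(\<Union>x\<in>cls b. cls (x \<otimes> a)) = (\<Union>x\<in>cls b. cls (b \<otimes> a))"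
    by (rule SUP_cong[OF refl])
  moreover have "cls b \<noteq> {}" using mem_cls[OF assms(2)] by blast
  moreover have "cls b \<in> carrier (Omega G C)" using assms by (simp add: carrier_Omega)
  ultimately show ?thesis by (simp only: R_map_def restrict_apply' UN_constant if_False)
qed

lemma R_map_Aut_chain:
  assumes a: "a \<in> carrier G"
  shows "R_map G C a \<in> carrier (Aut_chain (Omega G C))"
proof (rule chain.Aut_chainI[OF chain_Omega])
  show "R_map G C a \<in> extensional (carrier (Omega G C))" by (simp add: R_map_def)
  fix X assume X: "X \<in> carrier (Omega G C)"
  then obtain b where b: "b \<in> carrier G" "X = cls b" unfolding carrier_Omega by blast
  show "R_map G C a X \<in> carrier (Omega G C)"
    using b a by (simp add: R_map_cls carrier_Omega)
  have "R_map G C a (cls (b \<otimes> inv a)) = X"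
    using a b by (simp add: R_map_cls m_assoc)
  moreover have "cls (b \<otimes> inv a) \<in> carrier (Omega G C)"
    using a b unfolding carrier_Omega by blast
  ultimately show "\<exists>Y\<in>carrier (Omega G C). R_map G C a Y = X" by blast
  fix Y assume "Y \<in> carrier (Omega G C)"
  then obtain c where c: "c \<in> carrier G" "Y = cls c" unfolding carrier_Omega by blast
  have "R_map G C a X \<sqsubseteq>\<^bsub>Omega G C\<^esub> R_map G C a Y \<longleftrightarrow> X \<sqsubseteq>\<^bsub>Omega G C\<^esub> Y"
    using a b c by (simp add: R_map_cls le_Omega precone_rel_cancel_right)
  then show "X \<sqsubseteq>\<^bsub>Omega G C\<^esub> Y \<Longrightarrow> R_map G C a X \<sqsubseteq>\<^bsub>Omega G C\<^esub> R_map G C a Y"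
    and "R_map G C a X \<sqsubseteq>\<^bsub>Omega G C\<^esub> R_map G C a Y \<Longrightarrow> X \<sqsubseteq>\<^bsub>Omega G C\<^esub> Y" by simp_all
qed

text \<open>The product in \<open>Aut_chain\<close> applies its left factor first, which is the
  order in which right translations compose.\<close>

lemma R_map_mult:
  assumes "a \<in> carrier G" "b \<in> carrier G"
  shows "R_map G C (a \<otimes> b) = R_map G C a \<otimes>\<^bsub>Aut_chain (Omega G C)\<^esub> R_map G C b"
proof (rule extensionalityI[where A = "carrier (Omega G C)"])
  fix X assume X: "X \<in> carrier (Omega G C)"
  then obtain c where c: "c \<in> carrier G" "X = cls c" unfolding carrier_Omega by blast
  show "R_map G C (a \<otimes> b) X = (R_map G C a \<otimes>\<^bsub>Aut_chain (Omega G C)\<^esub> R_map G C b) X"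
    using X c assms by (simp add: compose_def R_map_cls m_assoc)
qed (simp_all add: R_map_def compose_extensional)

text \<open>Comparison at the class of \<open>c\<close> is membership in \<open>C\<close> of the
  conjugate by \<open>c\<close>. The order on translations thus depends on the intersection of all
  conjugates of \<open>C\<close>, while \<open>C\<close> itself is seen only at the class of the
  identity.\<close>

lemma R_map_le_iff:
  assumes "a \<in> carrier G" "b \<in> carrier G"
  shows "R_map G C a \<preceq>\<^bsub>Aut_chain (Omega G C)\<^esub> R_map G C b \<longleftrightarrow>
    (\<forall>c\<in>carrier G. c \<otimes> (b \<otimes> inv a) \<otimes> inv c \<in> C)"
  using assms
  by (simp add: carrier_Omega R_map_cls le_Omega precone_rel_iff inv_mult_group m_assoc)

lemma l_group_Aut_chain_Omega: "l_group (Aut_chain (Omega G C))"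
  by (rule chain.l_group_Aut_chain[OF chain_Omega])

lemma R_map_image_subset: "R_map G C ` carrier G \<subseteq> carrier (Aut_chain (Omega G C))"
  using R_map_Aut_chain by blast

lemma H_grp_simps [simp]:
  "carrier (H_grp G C) = l_generate (Aut_chain (Omega G C)) (R_map G C ` carrier G)"
  "x \<otimes>\<^bsub>H_grp G C\<^esub> y = x \<otimes>\<^bsub>Aut_chain (Omega G C)\<^esub> y"
  "\<one>\<^bsub>H_grp G C\<^esub> = \<one>\<^bsub>Aut_chain (Omega G C)\<^esub>"
  "x \<preceq>\<^bsub>H_grp G C\<^esub> y \<longleftrightarrow> x \<preceq>\<^bsub>Aut_chain (Omega G C)\<^esub> y"
  by (simp_all add: H_grp_def)

lemma l_group_H_grp: "l_group (H_grp G C)"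
  unfolding H_grp_def
  by (rule l_subgroup_l_group(1)[OF l_group_Aut_chain_Omega
        l_subgroup_l_generate(1)[OF l_group_Aut_chain_Omega R_map_image_subset]])

lemma carrier_H_grp_subset: "carrier (H_grp G C) \<subseteq> carrier (Aut_chain (Omega G C))"
  using l_subgroup_l_generate(1)[OF l_group_Aut_chain_Omega R_map_image_subset]
  unfolding l_subgroup_def H_grp_simps(1) by (blast dest: subgroup.subset)

lemma join_H_grp:
  assumes "f \<in> carrier (H_grp G C)" "g \<in> carrier (H_grp G C)" "X \<in> carrier (Omega G C)"
  shows "(f \<squnion>\<^bsub>order_of (H_grp G C)\<^esub> g) X = (if f X \<sqsubseteq>\<^bsub>Omega G C\<^esub> g X then g X else f X)"
proof -
  have "f \<squnion>\<^bsub>order_of (H_grp G C)\<^esub> g = f \<squnion>\<^bsub>order_of (Aut_chain (Omega G C))\<^esub> g"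
    unfolding H_grp_def
    by (rule l_subgroup_l_group(2)[OF l_group_Aut_chain_Omega
          l_subgroup_l_generate(1)[OF l_group_Aut_chain_Omega R_map_image_subset]])
      (use assms in simp_all)
  moreover have "f \<in> carrier (Aut_chain (Omega G C))" "g \<in> carrier (Aut_chain (Omega G C))"
    using assms carrier_H_grp_subset by blast+
  ultimately show ?thesis
    using chain.join_Aut_chain[OF chain_Omega] assms(3) by simp
qed

lemma R_map_pos_hom: "R_map G C \<in> pos_hom G (H_grp G C)"
proof -
  have "R_map G C a \<in> carrier (H_grp G C)" if "a \<in> carrier G" for a
    using l_subgroup_l_generate(2)[OF l_group_Aut_chain_Omega R_map_image_subset] that by auto
  moreover have "R_map G C a \<preceq>\<^bsub>H_grp G C\<^esub> R_map G C b" if ab: "a \<in> carrier G" "b \<in> carrier G" "a \<preceq> b" for a b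
  proof -
    have "c \<otimes> (b \<otimes> inv a) \<otimes> inv c \<in> C" if "c \<in> carrier G" for c
    proof (rule total_cone_pos[OF cone])
      show "\<one> \<preceq> c \<otimes> (b \<otimes> inv a) \<otimes> inv c"
        using mult_both_mono[of \<one> "b \<otimes> inv a" c "inv c"] ple_iff_one_ple[OF ab(1,2)] ab that by simp
    qed (use ab that in simp)
    then show ?thesis using R_map_le_iff[OF ab(1,2)] by (simp only: H_grp_simps(4)) blast
  qed
  ultimately show ?thesis
    using R_map_mult by (simp add: pos_hom_def hom_def)
qed

lemma R_map_closed: "a \<in> carrier G \<Longrightarrow> R_map G C a \<in> carrier (H_grp G C)"
  using R_map_pos_hom unfolding pos_hom_def hom_def by blast

lemma R_map_one_cls: "a \<in> carrier G \<Longrightarrow> R_map G C a (cls \<one>) = cls a"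
  by (simp add: R_map_cls)

lemma le_Omega_one: "a \<in> carrier G \<Longrightarrow> cls \<one> \<sqsubseteq>\<^bsub>Omega G C\<^esub> cls a \<longleftrightarrow> a \<in> C"
  by (simp add: le_Omega precone_rel_iff)

lemma mem_cone_if_R_map_pos:
  assumes "a \<in> carrier G" "\<one>\<^bsub>H_grp G C\<^esub> \<preceq>\<^bsub>H_grp G C\<^esub> R_map G C a"
  shows "a \<in> C"
proof -
  have "cls \<one> \<in> carrier (Omega G C)" by (simp add: carrier_Omega)
  then have "cls \<one> \<sqsubseteq>\<^bsub>Omega G C\<^esub> R_map G C a (cls \<one>)" using assms(2) by auto
  then show ?thesis using assms(1) by (simp add: R_map_one_cls le_Omega_one)
qed

text \<open>For a normal cone, comparison at one point decides comparison at all points, so any two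
  translations are comparable. The group of translations is then closed under joins and meets, and
  generating an l-subgroup from it adds no elements.\<close>

lemma to_group_H_grp:
  assumes conj: "\<And>g a. g \<in> carrier G \<Longrightarrow> a \<in> C \<Longrightarrow> g \<otimes> a \<otimes> inv g \<in> C"
  shows "carrier (H_grp G C) = R_map G C ` carrier G" "to_group (H_grp G C)"
proof -
  let ?A = "Aut_chain (Omega G C)"
  interpret A: l_grp ?A using l_group_Aut_chain_Omega by (rule l_grpI)
  interpret R: group_hom G ?A "R_map G C"
    by unfold_locales (simp add: hom_def R_map_Aut_chain R_map_mult del: Aut_chain_simps)
  have tot: "R_map G C a \<preceq>\<^bsub>?A\<^esub> R_map G C b \<or> R_map G C b \<preceq>\<^bsub>?A\<^esub> R_map G C a"
    if "a \<in> carrier G" "b \<in> carrier G" for a b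
    using precone_rel_total[OF that] conj
    by (simp add: R_map_le_iff that precone_rel_iff del: Aut_chain_simps) blast
  have "l_subgroup (R_map G C ` carrier G) ?A"
    unfolding l_subgroup_def
  proof (intro conjI ballI)
    fix f g assume fg: "f \<in> R_map G C ` carrier G" "g \<in> R_map G C ` carrier G"
    then have A: "f \<in> carrier ?A" "g \<in> carrier ?A" using R_map_image_subset by auto
    have cases: "f \<preceq>\<^bsub>?A\<^esub> g \<or> g \<preceq>\<^bsub>?A\<^esub> f" using fg tot by blast
    then show "f \<squnion>\<^bsub>order_of ?A\<^esub> g \<in> R_map G C ` carrier G"
      using A.join_absorb1[OF A] A.join_absorb2[OF A] fg by metis
    have "g \<sqinter>\<^bsub>order_of ?A\<^esub> f = f \<sqinter>\<^bsub>order_of ?A\<^esub> g"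
      by (simp add: Lattice.meet_def insert_commute)
    then show "f \<sqinter>\<^bsub>order_of ?A\<^esub> g \<in> R_map G C ` carrier G"
      using cases A.meet_absorb1[OF A] A.meet_absorb1[OF A(2,1)] fg by metis
  qed (rule R.img_is_subgroup)
  then show eq: "carrier (H_grp G C) = R_map G C ` carrier G"
    using l_generate_least[of _ ?A "R_map G C ` carrier G"]
      l_subgroup_l_generate(2)[OF l_group_Aut_chain_Omega R_map_image_subset] by auto
  have "f \<preceq>\<^bsub>H_grp G C\<^esub> g \<or> g \<preceq>\<^bsub>H_grp G C\<^esub> f"
    if "f \<in> carrier (H_grp G C)" "g \<in> carrier (H_grp G C)" for f g
    using that tot unfolding eq H_grp_simps(4) by blast
  then show "to_group (H_grp G C)"
    using l_group_H_grp unfolding to_group_def total_order_order_of_iff l_group_def po_group_def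
    by blast
qed

end

text \<open>Normality makes \<open>H_C\<close> totally ordered, hence representable. In the Abelian
  case the conjugates of all commutators lie in \<open>C\<close>, so the translations by
  \<open>a \<otimes> b\<close> and \<open>b \<otimes> a\<close> lie below each other and
  agree.\<close>

lemma variety_cone_in_P_set:
  assumes G: "po_group G" and C: "variety_cone V G C" "C \<noteq> carrier G"
  shows "C \<in> P_set V G"
proof -
  interpret cone_grp G C by (rule cone_grpI[OF G variety_cone_total[OF C(1)]])
  have to: "carrier (H_grp G C) = R_map G C ` carrier G" "to_group (H_grp G C)" if "V \<noteq> All"
    using to_group_H_grp variety_cone_conj[OF C(1) that] by blast+
  have "in_variety V (H_grp G C)"
  proof (cases V)
    case All
    then show ?thesis using l_group_H_grp by simp
  next
    case Representable
    then show ?thesis using to(2) to_group_imp_representable by simp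
  next
    case Abelian
    then have VA: "V \<noteq> All" by simp
    interpret H: l_grp "H_grp G C" by (rule l_grpI[OF l_group_H_grp])
    have le: "R_map G C (a \<otimes>\<^bsub>G\<^esub> b) \<preceq>\<^bsub>H_grp G C\<^esub> R_map G C (b \<otimes>\<^bsub>G\<^esub> a)"
      if "a \<in> carrier G" "b \<in> carrier G" for a b
    proof -
      have "c \<otimes>\<^bsub>G\<^esub> (b \<otimes>\<^bsub>G\<^esub> a \<otimes>\<^bsub>G\<^esub> inv\<^bsub>G\<^esub> (a \<otimes>\<^bsub>G\<^esub> b)) \<otimes>\<^bsub>G\<^esub> inv\<^bsub>G\<^esub> c \<in> C" if "c \<in> carrier G" for c
        using variety_cone_conj[OF C(1) VA that] variety_cone_commutator[OF C(1) Abelian]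
          \<open>a \<in> carrier G\<close> \<open>b \<in> carrier G\<close> by blast
      then show ?thesis
        using R_map_le_iff[of "a \<otimes>\<^bsub>G\<^esub> b" "b \<otimes>\<^bsub>G\<^esub> a"] that by (simp only: H_grp_simps(4) m_closed) blast
    qed
    have "comm_group (H_grp G C)"
    proof (rule H.group_comm_groupI)
      fix f g assume "f \<in> carrier (H_grp G C)" "g \<in> carrier (H_grp G C)"
      then obtain a b where ab: "f = R_map G C a" "g = R_map G C b" "a \<in> carrier G" "b \<in> carrier G"
        unfolding to(1)[OF VA] by blast
      have "R_map G C (a \<otimes>\<^bsub>G\<^esub> b) = R_map G C (b \<otimes>\<^bsub>G\<^esub> a)"
        using H.ple_antisym[OF _ _ le le] ab R_map_closed by simp
      then show "f \<otimes>\<^bsub>H_grp G C\<^esub> g = g \<otimes>\<^bsub>H_grp G C\<^esub> f"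
        using ab R_map_mult by simp
    qed
    then show ?thesis using l_group_H_grp Abelian by simp
  qed
  then show ?thesis
    using C precones_iff[OF G] variety_cone_total by (simp add: P_set_def) blast
qed

text \<open>Finitely many elements outside \<open>C\<close> have a common upper bound in \<open>H\<^sub>C\<close> that moves the
  class of the identity down, hence all of them are avoided by the preimage of a cone of \<open>H\<^sub>C\<close>.\<close>

lemma P_set_contains_variety_cone:
  assumes G: "po_group G" and C: "C \<in> P_set V G"
  shows "\<exists>D. variety_cone V G D \<and> D \<subseteq> C"
proof -
  have pre: "total_cone G C" "C \<noteq> carrier G" and V: "in_variety V (H_grp G C)"
    using C precones_iff[OF G] by (auto simp: P_set_def)
  interpret cone_grp G C by (rule cone_grpI[OF G pre(1)])
  interpret H: l_grp "H_grp G C" by (rule l_grpI[OF l_group_H_grp])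
  have one: "cls \<one>\<^bsub>G\<^esub> \<in> carrier (Omega G C)" by (simp add: carrier_Omega)
  \<comment> \<open>Properness of \<open>C\<close> supplies the bound for the empty set, from which
    the induction starts.\<close>
  obtain a0 where a0: "a0 \<in> carrier G" "a0 \<notin> C" using pre(2) cone_carrier by blast
  have bound: "\<exists>x\<in>carrier (H_grp G C). \<not> cls \<one>\<^bsub>G\<^esub> \<sqsubseteq>\<^bsub>Omega G C\<^esub> x (cls \<one>\<^bsub>G\<^esub>) \<and>
      (\<forall>a\<in>A. R_map G C a \<preceq>\<^bsub>H_grp G C\<^esub> x)"
    if "finite A" "A \<subseteq> carrier G - C" for A
    using that
  proof (induction A)
    case empty
    have "\<not> cls \<one>\<^bsub>G\<^esub> \<sqsubseteq>\<^bsub>Omega G C\<^esub> R_map G C a0 (cls \<one>\<^bsub>G\<^esub>)"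
      using a0 by (simp add: R_map_one_cls le_Omega_one)
    then show ?case using R_map_closed[OF a0(1)] by blast
  next
    case (insert a A)
    then obtain x where x: "x \<in> carrier (H_grp G C)" "\<not> cls \<one>\<^bsub>G\<^esub> \<sqsubseteq>\<^bsub>Omega G C\<^esub> x (cls \<one>\<^bsub>G\<^esub>)"
      "\<And>b. b \<in> A \<Longrightarrow> R_map G C b \<preceq>\<^bsub>H_grp G C\<^esub> x" by blast
    have a: "a \<in> carrier G" "a \<notin> C" using insert.prems by auto
    note aH = R_map_closed[OF a(1)]
    let ?y = "x \<squnion>\<^bsub>order_of (H_grp G C)\<^esub> R_map G C a"
    have "?y \<in> carrier (H_grp G C)" by (rule H.join_closed[OF x(1) aH])
    \<comment> \<open>At the class of the identity the join takes one of its two values, and both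
      lie strictly below that class.\<close>
    moreover have "\<not> cls \<one>\<^bsub>G\<^esub> \<sqsubseteq>\<^bsub>Omega G C\<^esub> ?y (cls \<one>\<^bsub>G\<^esub>)"
      using join_H_grp[OF x(1) aH one] x(2) a by (simp add: R_map_one_cls le_Omega_one)
    moreover have "R_map G C b \<preceq>\<^bsub>H_grp G C\<^esub> ?y" if "b \<in> insert a A" for b
    proof (cases "b = a")
      case True
      then show ?thesis using H.join_ge2[OF x(1) aH] by (simp only:)
    next
      case False
      then have "b \<in> A" "b \<in> carrier G" using that insert.prems by auto
      then show ?thesis
        by (intro H.ple_trans[OF R_map_closed x(1) H.join_closed[OF x(1) aH] x(3) H.join_ge1[OF x(1) aH]])
    qed
    ultimately show ?case by blast
  qed
  have "\<exists>D. variety_cone V G D \<and> (carrier G - C) \<inter> D = {}"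
  proof (rule variety_cone_avoiding[OF G])
    fix A assume A: "finite A" "A \<subseteq> carrier G - C"
    obtain x where x: "x \<in> carrier (H_grp G C)" "\<not> cls \<one>\<^bsub>G\<^esub> \<sqsubseteq>\<^bsub>Omega G C\<^esub> x (cls \<one>\<^bsub>G\<^esub>)"
      and ub: "\<And>a. a \<in> A \<Longrightarrow> R_map G C a \<preceq>\<^bsub>H_grp G C\<^esub> x" using bound[OF A] by blast
    have "\<not> \<one>\<^bsub>H_grp G C\<^esub> \<preceq>\<^bsub>H_grp G C\<^esub> x" using x(2) one by auto
    then obtain D where D: "variety_cone V (H_grp G C) D" "x \<notin> D"
      using variety_cone_notin[OF V x(1)] by blast
    note tD = variety_cone_total[OF D(1)]
    \<comment> \<open>As \<open>x\<close> lies above the translation by \<open>a\<close>, their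
      quotient is positive and belongs to \<open>D\<close>; if the translation belonged to
      \<open>D\<close> as well, so would \<open>x\<close>.\<close>
    have "R_map G C a \<notin> D" if "a \<in> A" for a
    proof
      assume aD: "R_map G C a \<in> D"
      have aH: "R_map G C a \<in> carrier (H_grp G C)" using that A R_map_closed by blast
      have "x \<otimes>\<^bsub>H_grp G C\<^esub> inv\<^bsub>H_grp G C\<^esub> R_map G C a \<in> D"
        by (rule total_cone_pos[OF tD H.m_closed[OF x(1) H.inv_closed[OF aH]]
              iffD1[OF H.ple_iff_one_ple[OF aH x(1)] ub[OF that]]])
      then have "x \<otimes>\<^bsub>H_grp G C\<^esub> inv\<^bsub>H_grp G C\<^esub> R_map G C a \<otimes>\<^bsub>H_grp G C\<^esub> R_map G C a \<in> D"
        by (rule total_cone_mult[OF tD _ aD])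
      then show False using D(2) H.inv_solve_right'[OF x(1) x(1) aH] H.m_assoc[OF x(1) H.inv_closed[OF aH] aH]
        H.l_inv[OF aH] H.r_one[OF x(1)] by (simp only:)
    qed
    then show "\<exists>D. variety_cone V G D \<and> A \<inter> D = {}"
      using variety_cone_vimage[OF G H.po_group R_map_pos_hom D(1)] by blast
  qed blast
  then show ?thesis
    using total_cone_subset[OF variety_cone_total] by blast
qed

section \<open>Orders as cones\<close>

lemma right_orders_iff:
  fixes K (structure)
  assumes K: "po_group K"
  shows "D \<in> right_orders K \<longleftrightarrow>
    total_cone K D \<and> D \<noteq> carrier K \<and> (\<forall>a\<in>D. inv a \<in> D \<longrightarrow> a = \<one>)"
proof
  assume "D \<in> right_orders K"
  then obtain r where r: "right_preorder K r" "antisym r" "D = cone_of K r"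
    by (auto simp: right_orders_def right_order_def)
  interpret po_grp K by (rule po_grpI[OF K])
  have "a = \<one>" if "a \<in> D" "inv a \<in> D" for a
  proof -
    have "a \<in> carrier K" "(\<one>, a) \<in> r" "(\<one>, inv a) \<in> r" using that r(3) by (auto simp: cone_of_def)
    moreover from this have "(\<one> \<otimes> a, inv a \<otimes> a) \<in> r"
      using r(1) unfolding right_preorder_def by blast
    ultimately show ?thesis using antisymD[OF r(2), of a \<one>] by simp
  qed
  then show "total_cone K D \<and> D \<noteq> carrier K \<and> (\<forall>a\<in>D. inv a \<in> D \<longrightarrow> a = \<one>)"
    using total_cone_cone_of[OF K r(1)] r(3) by blast
next
  assume D: "total_cone K D \<and> D \<noteq> carrier K \<and> (\<forall>a\<in>D. inv a \<in> D \<longrightarrow> a = \<one>)"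
  then interpret cone_grp K D using K by (simp add: cone_grpI)
  have "antisym (precone_rel K D)"
  proof (rule antisymI)
    fix a b assume "(a, b) \<in> precone_rel K D" "(b, a) \<in> precone_rel K D"
    then have ab: "a \<in> carrier K" "b \<in> carrier K" "b \<otimes> inv a \<in> D" "inv (b \<otimes> inv a) \<in> D"
      by (auto simp: precone_rel_iff inv_mult_group)
    then have "b \<otimes> inv a = \<one>" using D by blast
    then show "a = b" using inv_solve_right[of \<one> b a] ab by simp
  qed
  then have "right_order K (precone_rel K D)"
    using right_preorder_precone_rel D by (simp add: right_order_def)
  then show "D \<in> right_orders K"
    unfolding right_orders_def using cone_of_precone_rel
    by (intro image_eqI[of _ _ "precone_rel K D"]) simp_all
qed

text \<open>Right invariance is built in, so left invariance amounts to invariance under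
  conjugation, which can be tested on elements above the identity.\<close>

lemma bi_orders_iff:
  fixes K (structure)
  assumes K: "po_group K"
  shows "D \<in> bi_orders K \<longleftrightarrow>
    D \<in> right_orders K \<and> (\<forall>g\<in>carrier K. \<forall>a\<in>D. g \<otimes> a \<otimes> inv g \<in> D)"
proof
  assume "D \<in> bi_orders K"
  then obtain r where r: "right_order K r" "D = cone_of K r"
    "\<And>a b s. s \<in> carrier K \<Longrightarrow> (a, b) \<in> r \<Longrightarrow> (s \<otimes> a, s \<otimes> b) \<in> r"
    by (auto simp: bi_orders_def bi_order_def)
  interpret po_grp K by (rule po_grpI[OF K])
  have "g \<otimes> a \<otimes> inv g \<in> D" if "g \<in> carrier K" "a \<in> D" for g a
  proof -
    have a: "a \<in> carrier K" "(\<one>, a) \<in> r" using that(2) r(2) by (auto simp: cone_of_def)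
    then have "(g \<otimes> \<one>, g \<otimes> a) \<in> r" using r(3) that(1) by blast
    then have "(g \<otimes> \<one> \<otimes> inv g, g \<otimes> a \<otimes> inv g) \<in> r"
      using r(1) inv_closed[OF that(1)] unfolding right_order_def right_preorder_def by blast
    then show ?thesis using r(2) that(1) a(1) by (simp add: cone_of_def)
  qed
  then show "D \<in> right_orders K \<and> (\<forall>g\<in>carrier K. \<forall>a\<in>D. g \<otimes> a \<otimes> inv g \<in> D)"
    using r(1,2) unfolding right_orders_def by blast
next
  assume D: "D \<in> right_orders K \<and> (\<forall>g\<in>carrier K. \<forall>a\<in>D. g \<otimes> a \<otimes> inv g \<in> D)"
  then obtain r where r: "right_order K r" "D = cone_of K r"
    by (auto simp: right_orders_def)
  interpret po_grp K by (rule po_grpI[OF K])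
  have rD: "r = precone_rel K D"
    using precone_rel_cone_of[OF K] r by (simp add: right_order_def)
  have "(s \<otimes> a, s \<otimes> b) \<in> r" if "s \<in> carrier K" "(a, b) \<in> r" for s a b
  proof -
    have ab: "a \<in> carrier K" "b \<in> carrier K" "b \<otimes> inv a \<in> D"
      using that(2) by (auto simp: rD precone_rel_iff)
    then have "s \<otimes> (b \<otimes> inv a) \<otimes> inv s \<in> D" using D that(1) by blast
    then show ?thesis using ab that(1) by (simp add: rD precone_rel_iff inv_mult_group m_assoc)
  qed
  then have "bi_order K r" using r(1) by (simp add: bi_order_def)
  then show "D \<in> bi_orders K" using r(2) by (simp add: bi_orders_def)
qed

section \<open>The minimal layer and the orders on the group image\<close>

locale free_extension = po_grp G for G :: "'a pogroup" (structure) +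
  fixes V :: variety and F :: "'f pogroup" and \<eta> :: "'a \<Rightarrow> 'f"
  assumes free_over: "free_over V G F \<eta>"
begin

sublocale F: l_grp F
  using free_over in_variety_imp_l_group[of V F] unfolding free_over_def by (blast intro: l_grpI)

lemma eta_pos_hom: "\<eta> \<in> pos_hom G F"
  using free_over by (simp add: free_over_def)

sublocale eta: group_hom G F \<eta>
  using eta_pos_hom by unfold_locales (simp add: pos_hom_def)

lemma in_variety_F: "in_variety V F"
  using free_over by (simp add: free_over_def)

text \<open>The induced l-homomorphism carries positivity of \<open>\<eta> a\<close> over to the
  translation by \<open>a\<close>. Evaluation at the class of the identity turns this into
  membership in \<open>C\<close>.\<close>

lemma P_set_mem_if_eta_pos:
  assumes C: "C \<in> P_set V G" and a: "a \<in> carrier G" "\<one>\<^bsub>F\<^esub> \<preceq>\<^bsub>F\<^esub> \<eta> a"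
  shows "a \<in> C"
proof -
  have "total_cone G C" and V: "in_variety V (H_grp G C)"
    using C precones_iff[OF po_group] by (auto simp: P_set_def)
  then interpret cone_grp G C by (intro cone_grpI po_group)
  have "universal_on TYPE('a set \<Rightarrow> 'a set) V G F \<eta>"
    using free_over by (simp add: free_over_def)
  then obtain h where h: "h \<in> l_hom F (H_grp G C)" "\<And>b. b \<in> carrier G \<Longrightarrow> h (\<eta> b) = R_map G C b"
    using V R_map_pos_hom unfolding universal_on_def by blast
  have pos: "h \<in> pos_hom F (H_grp G C)"
    by (rule l_hom_imp_pos_hom[OF F.l_group l_group_H_grp h(1)])
  have "h \<one>\<^bsub>F\<^esub> = R_map G C \<one>\<^bsub>G\<^esub>" using h(2)[of "\<one>\<^bsub>G\<^esub>"] by simp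
  also have "\<dots> = \<one>\<^bsub>H_grp G C\<^esub>"
    using R_map_pos_hom hom_one l_group_H_grp is_group
    unfolding pos_hom_def l_group_def po_group_def by blast
  finally have "\<one>\<^bsub>H_grp G C\<^esub> \<preceq>\<^bsub>H_grp G C\<^esub> R_map G C a"
    using pos a h(2)[OF a(1)] eta.hom_closed[OF a(1)] F.one_closed unfolding pos_hom_def by fastforce
  then show ?thesis by (rule mem_cone_if_R_map_pos[OF a(1)])
qed

text \<open>Only one inclusion between the kernel of \<open>\<eta>\<close> and the elements lying in
  \<open>C\<close> with their inverses is written down. The other holds throughout
  \<open>P_set V G\<close> by \<open>P_set_mem_if_eta_pos\<close>.\<close>

definition kernel_cones :: "'a set set" where
  "kernel_cones = {C. variety_cone V G C \<and> C \<noteq> carrier G \<and> (\<forall>a\<in>C. inv a \<in> C \<longrightarrow> \<eta> a = \<one>\<^bsub>F\<^esub>)}"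

lemma kernel_cones_subset_P_set: "C \<in> kernel_cones \<Longrightarrow> C \<in> P_set V G"
  using variety_cone_in_P_set[OF po_group] by (simp add: kernel_cones_def)

text \<open>Nested total cones differ only in elements whose inverses lie in the smaller cone. In a
  kernel cone such elements are killed by \<open>\<eta>\<close>, and then they lie in every member
  of \<open>P_set V G\<close>.\<close>

lemma kernel_cone_minimal:
  assumes C: "C \<in> kernel_cones" and D: "D \<in> P_set V G" "D \<subseteq> C"
  shows "D = C"
proof -
  obtain E where E: "variety_cone V G E" "E \<subseteq> D"
    using P_set_contains_variety_cone[OF po_group D(1)] by blast
  have CG: "C \<subseteq> carrier G" "C \<noteq> carrier G"
    using C total_cone_subset[OF variety_cone_total] by (auto simp: kernel_cones_def)
  then have EP: "E \<in> P_set V G"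
    using E D by (intro variety_cone_in_P_set[OF po_group]) auto
  have "a \<in> E" if "a \<in> C" for a
  proof (rule ccontr)
    assume no: "a \<notin> E"
    have a: "a \<in> carrier G" using that CG by blast
    then have "inv a \<in> C" using total_cone_total[OF variety_cone_total[OF E(1)] a no] E(2) D(2) by blast
    then have "\<eta> a = \<one>\<^bsub>F\<^esub>" using C that by (simp add: kernel_cones_def)
    then show False using P_set_mem_if_eta_pos[OF EP a] no by (simp add: F.ple_refl)
  qed
  then show ?thesis using E(2) D(2) by blast
qed

lemma minimal_imp_kernel_cone:
  assumes C: "C \<in> P_set V G" and min: "\<And>D. D \<in> P_set V G \<Longrightarrow> D \<subseteq> C \<Longrightarrow> D = C"
  shows "C \<in> kernel_cones"
proof -
  have proper: "C \<subseteq> carrier G" "C \<noteq> carrier G"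
    using C precones_iff[OF po_group] total_cone_subset by (auto simp: P_set_def)
  \<comment> \<open>A \<open>V\<close>-cone inside \<open>C\<close> is proper and so competes for
    minimality. This shows that \<open>C\<close> is itself a \<open>V\<close>-cone and, further
    down, that its refinement cannot be smaller.\<close>
  have below: "D = C" if "variety_cone V G D" "D \<subseteq> C" for D
    using variety_cone_in_P_set[OF po_group that(1)] min[OF _ that(2)] that(2) proper by blast
  then have vC: "variety_cone V G C" using P_set_contains_variety_cone[OF po_group C] by blast
  have pos: "\<one>\<^bsub>F\<^esub> \<preceq>\<^bsub>F\<^esub> \<eta> b" if b: "b \<in> C" "inv b \<in> C" for b
  proof (rule ccontr)
    assume no: "\<not> \<one>\<^bsub>F\<^esub> \<preceq>\<^bsub>F\<^esub> \<eta> b"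
    have bG: "b \<in> carrier G" using b proper by blast
    obtain D where D: "variety_cone V F D" "\<eta> b \<notin> D"
      using variety_cone_notin[OF in_variety_F eta.hom_closed[OF bG] no] by blast
    \<comment> \<open>The refinement loses \<open>b\<close>: both \<open>b\<close> and
      \<open>inv b\<close> lie in \<open>C\<close>, so the preimage of \<open>D\<close> decides, and
      it misses \<open>b\<close>.\<close>
    let ?L = "{a \<in> C. inv a \<in> C \<longrightarrow> a \<in> {a \<in> carrier G. \<eta> a \<in> D}}"
    have "variety_cone V G ?L"
      by (rule variety_cone_lex[OF po_group vC
            variety_cone_vimage[OF po_group F.po_group eta_pos_hom D(1)]])
    then have "?L = C" by (rule below) blast
    then show False using b D(2) by blast
  qed
  have "\<eta> a = \<one>\<^bsub>F\<^esub>" if a: "a \<in> C" "inv a \<in> C" for a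
  proof -
    have aG: "a \<in> carrier G" using a proper by blast
    \<comment> \<open>Both \<open>a\<close> and \<open>inv a\<close> satisfy the premises of
      \<open>pos\<close>, and positivity of \<open>\<eta> (inv a)\<close> bounds
      \<open>\<eta> a\<close> from above.\<close>
    then have "\<eta> a \<preceq>\<^bsub>F\<^esub> \<one>\<^bsub>F\<^esub>"
      using pos[of "inv a"] a F.one_ple_inv_iff[of "\<eta> a"] by simp
    then show ?thesis using F.ple_antisym[of "\<eta> a" "\<one>\<^bsub>F\<^esub>"] pos[OF a] aG by simp
  qed
  then show ?thesis using vC proper by (simp add: kernel_cones_def)
qed

lemma minimal_P_set_eq: "{C \<in> P_set V G. \<forall>D\<in>P_set V G. D \<subseteq> C \<longrightarrow> D = C} = kernel_cones"
proof (intro Set.equalityI subsetI)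
  fix C assume "C \<in> {C \<in> P_set V G. \<forall>D\<in>P_set V G. D \<subseteq> C \<longrightarrow> D = C}"
  then show "C \<in> kernel_cones" by (intro minimal_imp_kernel_cone) simp_all
next
  fix C assume C: "C \<in> kernel_cones"
  then show "C \<in> {C \<in> P_set V G. \<forall>D\<in>P_set V G. D \<subseteq> C \<longrightarrow> D = C}"
    using kernel_cones_subset_P_set[OF C] kernel_cone_minimal[OF C] by simp
qed

section \<open>The partially ordered group \<open>\<eta>[G]\<close> and its orders\<close>

abbreviation K :: "'f pogroup" where
  "K \<equiv> group_image G F \<eta>"

lemma K_simps [simp]:
  "carrier K = \<eta> ` carrier G" "x \<otimes>\<^bsub>K\<^esub> y = x \<otimes>\<^bsub>F\<^esub> y" "\<one>\<^bsub>K\<^esub> = \<one>\<^bsub>F\<^esub>"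
  "x \<preceq>\<^bsub>K\<^esub> y \<longleftrightarrow> x \<preceq>\<^bsub>F\<^esub> y"
  by (simp_all add: group_image_def)

lemma group_K: "group K"
  unfolding group_image_def by (rule F.subgroup_imp_group[OF eta.img_is_subgroup])

lemma inv_K: "a \<in> carrier G \<Longrightarrow> inv\<^bsub>K\<^esub> (\<eta> a) = \<eta> (inv a)"
  using group.m_inv_consistent[OF F.is_group eta.img_is_subgroup, of "\<eta> a"]
  by (simp add: group_image_def)

lemma po_group_K: "po_group K"
proof -
  have "partial_order (order_of K)"
  proof (rule partial_order_order_ofI)
    fix x y z assume "x \<in> carrier K" "y \<in> carrier K" "z \<in> carrier K" "x \<preceq>\<^bsub>K\<^esub> y" "y \<preceq>\<^bsub>K\<^esub> z"
    then show "x \<preceq>\<^bsub>K\<^esub> z" using F.ple_trans[of x y z] by auto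
  qed (auto intro: F.ple_refl F.ple_antisym)
  moreover have "s \<otimes>\<^bsub>K\<^esub> a \<otimes>\<^bsub>K\<^esub> t \<preceq>\<^bsub>K\<^esub> s \<otimes>\<^bsub>K\<^esub> b \<otimes>\<^bsub>K\<^esub> t"
    if "a \<in> carrier K" "b \<in> carrier K" "s \<in> carrier K" "t \<in> carrier K" "a \<preceq>\<^bsub>K\<^esub> b" for a b s t
    using F.mult_both_mono[of a b s t] that by auto
  ultimately show ?thesis
    unfolding po_group_def using group_K by blast
qed

definition image_orders :: "'f set set" where
  "image_orders = {D. variety_cone V K D \<and> D \<noteq> carrier K \<and> (\<forall>b\<in>D. inv\<^bsub>K\<^esub> b \<in> D \<longrightarrow> b = \<one>\<^bsub>K\<^esub>)}"

text \<open>In the Abelian case \<open>F\<close> is commutative, so commutators in the image are the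
  identity and lie in every cone. The \<open>V\<close>-cones of the image are then its normal cones,
  as in the representable case.\<close>

lemma image_orders_eq: "image_orders = (if V = All then right_orders K else bi_orders K)"
proof -
  interpret K: group K by (rule group_K)
  have "a \<otimes>\<^bsub>K\<^esub> b \<otimes>\<^bsub>K\<^esub> inv\<^bsub>K\<^esub> (b \<otimes>\<^bsub>K\<^esub> a) \<in> D"
    if D: "total_cone K D" and V: "V = Abelian" and ab: "a \<in> carrier K" "b \<in> carrier K" for a b D
  proof -
    have "comm_group F" using in_variety_F V by simp
    then have "a \<otimes>\<^bsub>K\<^esub> b = b \<otimes>\<^bsub>K\<^esub> a"
      using ab comm_monoid.m_comm[of F a b] by (auto simp: comm_group_def)
    then have "a \<otimes>\<^bsub>K\<^esub> b \<otimes>\<^bsub>K\<^esub> inv\<^bsub>K\<^esub> (b \<otimes>\<^bsub>K\<^esub> a) = \<one>\<^bsub>K\<^esub>"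
      using K.r_inv[OF K.m_closed[OF ab(2,1)]] by (simp only:)
    then show ?thesis using total_cone_one[OF po_group_K D] by (simp only:)
  qed
  then have "variety_cone V K D \<longleftrightarrow> total_cone K D \<and>
     (V \<noteq> All \<longrightarrow> (\<forall>g\<in>carrier K. \<forall>a\<in>D. g \<otimes>\<^bsub>K\<^esub> a \<otimes>\<^bsub>K\<^esub> inv\<^bsub>K\<^esub> g \<in> D))" for D
    unfolding variety_cone_def by blast
  then show ?thesis
    unfolding image_orders_def using right_orders_iff[OF po_group_K] bi_orders_iff[OF po_group_K] by auto
qed

lemma eta_pos_hom_K: "\<eta> \<in> pos_hom G K"
  using eta_pos_hom by (auto simp: pos_hom_def hom_def)

text \<open>A subset of the image is recovered from its preimage. This also transfers properness: a
  preimage equal to \<open>G\<close> would make \<open>D\<close> the whole image.\<close>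

lemma vimage_image_order:
  assumes D: "D \<in> image_orders"
  shows "{a \<in> carrier G. \<eta> a \<in> D} \<in> kernel_cones" and "\<eta> ` {a \<in> carrier G. \<eta> a \<in> D} = D"
proof -
  have D': "variety_cone V K D" "D \<noteq> carrier K" "\<And>b. b \<in> D \<Longrightarrow> inv\<^bsub>K\<^esub> b \<in> D \<Longrightarrow> b = \<one>\<^bsub>F\<^esub>"
    using D by (auto simp: image_orders_def)
  have DK: "D \<subseteq> \<eta> ` carrier G"
    using total_cone_subset[OF variety_cone_total[OF D'(1)]] by simp
  then show im: "\<eta> ` {a \<in> carrier G. \<eta> a \<in> D} = D" by blast
  have "{a \<in> carrier G. \<eta> a \<in> D} \<noteq> carrier G" using im D'(2) by auto
  moreover have "\<eta> a = \<one>\<^bsub>F\<^esub>" if "a \<in> carrier G" "\<eta> a \<in> D" "\<eta> (inv a) \<in> D" for a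
    using D'(3)[OF that(2)] inv_K[OF that(1)] that(3) by simp
  ultimately show "{a \<in> carrier G. \<eta> a \<in> D} \<in> kernel_cones"
    unfolding kernel_cones_def
    using variety_cone_vimage[OF po_group po_group_K eta_pos_hom_K D'(1)] by blast
qed

lemma image_kernel_cone:
  assumes C: "C \<in> kernel_cones"
  shows "{a \<in> carrier G. \<eta> a \<in> \<eta> ` C} = C" and "\<eta> ` C \<in> image_orders"
proof -
  have vC: "variety_cone V G C" and proper: "C \<noteq> carrier G"
    and ker: "\<And>a. a \<in> C \<Longrightarrow> inv a \<in> C \<Longrightarrow> \<eta> a = \<one>\<^bsub>F\<^esub>"
    using C by (auto simp: kernel_cones_def)
  note tC = variety_cone_total[OF vC]
  note CG = subsetD[OF total_cone_subset[OF tC]]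
  have pos: "a \<in> C" if "a \<in> carrier G" "\<one>\<^bsub>F\<^esub> \<preceq>\<^bsub>F\<^esub> \<eta> a" for a
    by (rule P_set_mem_if_eta_pos[OF kernel_cones_subset_P_set[OF C] that])
  \<comment> \<open>\<open>C\<close> is a union of fibres of \<open>\<eta>\<close>: elements with
    equal images differ by a kernel element, which lies in \<open>C\<close>. This keeps the image
    cone proper and brings a tie in the image back to a tie in \<open>C\<close>.\<close>
  have sat: "a \<in> C" if "a \<in> carrier G" "c \<in> C" "\<eta> a = \<eta> c" for a c
  proof -
    have "a \<otimes> inv c \<in> C"
      using that CG by (intro pos) (auto simp: F.ple_refl)
    then have "a \<otimes> inv c \<otimes> c \<in> C" using total_cone_mult[OF tC _ that(2)] by blast
    then show ?thesis using that(1) CG[OF that(2)] by (simp add: m_assoc)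
  qed
  show vim: "{a \<in> carrier G. \<eta> a \<in> \<eta> ` C} = C"
    using sat CG by blast
  have "variety_cone V K (\<eta> ` C)"
  proof (rule variety_coneI)
    show "total_cone K (\<eta> ` C)"
    proof (rule total_coneI)
      show "\<eta> ` C \<subseteq> carrier K" using CG by auto
      show "b \<in> \<eta> ` C" if "b \<in> carrier K" "\<one>\<^bsub>K\<^esub> \<preceq>\<^bsub>K\<^esub> b" for b
        using that pos by auto
      show "b \<otimes>\<^bsub>K\<^esub> c \<in> \<eta> ` C" if bc: "b \<in> \<eta> ` C" "c \<in> \<eta> ` C" for b c
      proof -
        obtain x y where "b = \<eta> x" "c = \<eta> y" "x \<in> C" "y \<in> C" using bc by blast
        then show ?thesis using total_cone_mult[OF tC, of x y] CG by (intro image_eqI[of _ _ "x \<otimes> y"]) simp_all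
      qed
      show "inv\<^bsub>K\<^esub> b \<in> \<eta> ` C" if b: "b \<in> carrier K" "b \<notin> \<eta> ` C" for b
      proof -
        obtain x where x: "b = \<eta> x" "x \<in> carrier G" using b(1) by auto
        then have "inv x \<in> C" using b(2) total_cone_total[OF tC x(2)] by blast
        then show ?thesis using inv_K[OF x(2)] x(1) by simp
      qed
    qed
  next
    fix g b assume V: "V \<noteq> All" and gb: "g \<in> carrier K" "b \<in> \<eta> ` C"
    then obtain x y where "g = \<eta> x" "b = \<eta> y" "x \<in> carrier G" "y \<in> C" by auto
    then show "g \<otimes>\<^bsub>K\<^esub> b \<otimes>\<^bsub>K\<^esub> inv\<^bsub>K\<^esub> g \<in> \<eta> ` C"
      using variety_cone_conj[OF vC V, of x y] CG[of y]
      by (intro image_eqI[of _ _ "x \<otimes> y \<otimes> inv x"]) (simp_all add: inv_K)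
  next
    fix b c assume V: "V = Abelian" and bc: "b \<in> carrier K" "c \<in> carrier K"
    then obtain x y where "b = \<eta> x" "c = \<eta> y" "x \<in> carrier G" "y \<in> carrier G" by auto
    then show "b \<otimes>\<^bsub>K\<^esub> c \<otimes>\<^bsub>K\<^esub> inv\<^bsub>K\<^esub> (c \<otimes>\<^bsub>K\<^esub> b) \<in> \<eta> ` C"
      using variety_cone_commutator[OF vC V, of x y] inv_K[of "y \<otimes> x"]
      by (intro image_eqI[of _ _ "x \<otimes> y \<otimes> inv (y \<otimes> x)"]) simp_all
  qed
  moreover have "\<eta> ` C \<noteq> carrier K" using vim proper by auto
  moreover have "b = \<one>\<^bsub>K\<^esub>" if b: "b \<in> \<eta> ` C" "inv\<^bsub>K\<^esub> b \<in> \<eta> ` C" for b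
  proof -
    obtain x where x: "b = \<eta> x" "x \<in> C" using b(1) by blast
    then have "\<eta> (inv x) \<in> \<eta> ` C" using b(2) inv_K CG by simp
    then have "inv x \<in> C" using vim CG[OF x(2)] by blast
    then show ?thesis using ker[OF x(2)] x(1) by simp
  qed
  ultimately show "\<eta> ` C \<in> image_orders" by (simp add: image_orders_def)
qed

section \<open>Comparison of the two topologies\<close>

lemma topspace_minimal_layer: "topspace (minimal_layer V G) = kernel_cones"
proof -
  have "topspace (P_space V G) = P_set V G" by (auto simp: P_space_def P_basic_def)
  then show ?thesis
    using kernel_cones_subset_P_set by (auto simp: minimal_layer_def minimal_P_set_eq)
qed

lemma openin_minimal_layer_basic:
  assumes "a \<in> carrier G"
  shows "openin (minimal_layer V G) {C \<in> kernel_cones. a \<in> C \<and> inv a \<notin> C}"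
proof -
  have "openin (P_space V G) (P_basic V G a)"
    unfolding P_space_def using assms by (intro topology_generated_by_Basis) blast
  moreover have "{C \<in> kernel_cones. a \<in> C \<and> inv a \<notin> C} = P_basic V G a \<inter> kernel_cones"
    using kernel_cones_subset_P_set by (auto simp: P_basic_def)
  ultimately show ?thesis
    unfolding minimal_layer_def minimal_P_set_eq openin_subtopology by blast
qed

lemma image_orders_subset: "image_orders \<subseteq> right_orders K"
  using right_orders_iff[OF po_group_K] variety_cone_total by (auto simp: image_orders_def)

lemma topspace_R_space: "topspace (R_space K) = right_orders K"
  by (auto simp: R_space_def)

lemma continuous_map_image:
  "continuous_map (minimal_layer V G) (subtopology (R_space K) image_orders) (image \<eta>)"
proof -
  have mem: "\<eta> a \<in> \<eta> ` C \<longleftrightarrow> a \<in> C" if "C \<in> kernel_cones" "a \<in> carrier G" for C a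
    using image_kernel_cone(1)[OF that(1)] that(2) by blast
  have tot: "a \<notin> C \<longleftrightarrow> inv a \<in> C \<and> a \<notin> C" if "C \<in> kernel_cones" "a \<in> carrier G" for C a
    using that total_cone_total[OF variety_cone_total] by (auto simp: kernel_cones_def)
  have "continuous_map (minimal_layer V G) (R_space K) (image \<eta>)"
    unfolding R_space_def
  proof (rule continuous_on_generated_topo)
    show "image \<eta> ` topspace (minimal_layer V G) \<subseteq> \<Union> (insert (right_orders K)
        ((\<lambda>a. {C \<in> right_orders K. a \<in> C}) ` carrier K \<union>
         (\<lambda>a. {C \<in> right_orders K. a \<notin> C}) ` carrier K))"
      using image_kernel_cone(2) image_orders_subset unfolding topspace_minimal_layer by blast
    fix U assume "U \<in> insert (right_orders K)
        ((\<lambda>a. {C \<in> right_orders K. a \<in> C}) ` carrier K \<union>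
         (\<lambda>a. {C \<in> right_orders K. a \<notin> C}) ` carrier K)"
    then consider "U = right_orders K"
      | a where "a \<in> carrier G" "U = {C \<in> right_orders K. \<eta> a \<in> C}"
      | a where "a \<in> carrier G" "U = {C \<in> right_orders K. \<eta> a \<notin> C}"
      by auto
    then show "openin (minimal_layer V G) (image \<eta> -` U \<inter> topspace (minimal_layer V G))"
    proof cases
      case 1
      then have "image \<eta> -` U \<inter> topspace (minimal_layer V G) = topspace (minimal_layer V G)"
        using image_kernel_cone(2) image_orders_subset unfolding topspace_minimal_layer by blast
      then show ?thesis by simp
    next
      case 2
      have "image \<eta> -` U \<inter> topspace (minimal_layer V G) = {C \<in> kernel_cones. a \<in> C}"
        using 2 mem image_kernel_cone(2) image_orders_subset unfolding topspace_minimal_layer by blast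
      \<comment> \<open>An element killed by \<open>\<eta>\<close> lies in every kernel cone; any
        other element cannot share a kernel cone with its inverse.\<close>
      also have "\<dots> = (if \<eta> a = \<one>\<^bsub>F\<^esub> then topspace (minimal_layer V G)
          else {C \<in> kernel_cones. a \<in> C \<and> inv a \<notin> C})"
      proof (cases "\<eta> a = \<one>\<^bsub>F\<^esub>")
        case True
        then have "a \<in> C" if "C \<in> kernel_cones" for C
          using P_set_mem_if_eta_pos[OF kernel_cones_subset_P_set[OF that] 2(1)] by (simp add: F.ple_refl)
        then show ?thesis using True by (auto simp: topspace_minimal_layer)
      next
        case False
        then show ?thesis by (auto simp: kernel_cones_def)
      qed
      finally show ?thesis using openin_minimal_layer_basic[OF 2(1)] by simp
    next
      case 3
      have "image \<eta> -` U \<inter> topspace (minimal_layer V G) = {C \<in> kernel_cones. a \<notin> C}"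
        using 3 mem image_kernel_cone(2) image_orders_subset unfolding topspace_minimal_layer by blast
      \<comment> \<open>By totality, missing \<open>a\<close> is the same as strict positivity of
        \<open>inv a\<close>.\<close>
      also have "\<dots> = {C \<in> kernel_cones. inv a \<in> C \<and> inv (inv a) \<notin> C}"
        using tot 3(1) by auto
      finally show ?thesis using openin_minimal_layer_basic[of "inv a"] 3(1) by simp
    qed
  qed
  moreover have "image \<eta> ` topspace (minimal_layer V G) \<subseteq> image_orders"
    using image_kernel_cone(2) unfolding topspace_minimal_layer by blast
  ultimately show ?thesis by (simp add: continuous_map_in_subtopology image_subset_iff_funcset)
qed

text \<open>By totality, an order that misses \<open>\<eta> (inv b)\<close> contains
  \<open>\<eta> b\<close>. The two conditions defining \<open>P_basic V G b\<close> therefore pull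
  back to a single subbasic condition of the second kind.\<close>

lemma continuous_map_vimage:
  "continuous_map (subtopology (R_space K) image_orders) (minimal_layer V G)
     (\<lambda>D. {a \<in> carrier G. \<eta> a \<in> D})"
proof -
  let ?Y = "subtopology (R_space K) image_orders"
  have top: "topspace ?Y = image_orders"
    using image_orders_subset by (auto simp: topspace_R_space)
  have "continuous_map ?Y (P_space V G) (\<lambda>D. {a \<in> carrier G. \<eta> a \<in> D})"
    unfolding P_space_def
  proof (rule continuous_on_generated_topo)
    show "(\<lambda>D. {a \<in> carrier G. \<eta> a \<in> D}) ` topspace ?Y \<subseteq> \<Union> (insert (P_set V G) (P_basic V G ` carrier G))"
      using vimage_image_order(1) kernel_cones_subset_P_set unfolding top by blast
    fix U assume "U \<in> insert (P_set V G) (P_basic V G ` carrier G)"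
    then consider "U = P_set V G" | b where "b \<in> carrier G" "U = P_basic V G b" by auto
    then show "openin ?Y ((\<lambda>D. {a \<in> carrier G. \<eta> a \<in> D}) -` U \<inter> topspace ?Y)"
    proof cases
      case 1
      then have "(\<lambda>D. {a \<in> carrier G. \<eta> a \<in> D}) -` U \<inter> topspace ?Y = topspace ?Y"
        using vimage_image_order(1) kernel_cones_subset_P_set unfolding top by blast
      then show ?thesis by (simp only: openin_topspace)
    next
      case 2
      have tot: "\<eta> b \<in> D" if "D \<in> image_orders" "\<eta> (inv b) \<notin> D" for D
        using that total_cone_total[OF variety_cone_total, of V K D "\<eta> b"] inv_K[OF 2(1)] 2(1)
        by (auto simp: image_orders_def)
      have "(\<lambda>D. {a \<in> carrier G. \<eta> a \<in> D}) -` U \<inter> topspace ?Y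
          = {D \<in> right_orders K. \<eta> (inv b) \<notin> D} \<inter> image_orders"
        using 2 tot vimage_image_order(1) kernel_cones_subset_P_set image_orders_subset
        unfolding top P_basic_def by (auto 4 3)
      moreover have "\<eta> (inv b) \<in> carrier K" using 2(1) by (simp del: eta.hom_inv)
      then have "openin (R_space K) {D \<in> right_orders K. \<eta> (inv b) \<notin> D}"
        unfolding R_space_def by (intro topology_generated_by_Basis) blast
      ultimately show ?thesis unfolding openin_subtopology by blast
    qed
  qed
  moreover have "(\<lambda>D. {a \<in> carrier G. \<eta> a \<in> D}) ` topspace ?Y \<subseteq> kernel_cones"
    using vimage_image_order(1) unfolding top by blast
  ultimately show ?thesis
    unfolding minimal_layer_def minimal_P_set_eq
    by (simp add: continuous_map_in_subtopology image_subset_iff_funcset)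
qed

lemma minimal_layer_homeomorphic:
  "minimal_layer V G homeomorphic_space subtopology (R_space K) image_orders"
  unfolding homeomorphic_space_def homeomorphic_maps_def
  using continuous_map_image continuous_map_vimage image_kernel_cone(1) vimage_image_order(2)
  by (intro exI[of _ "image \<eta>"] exI[of _ "\<lambda>D. {a \<in> carrier G. \<eta> a \<in> D}"])
    (auto simp: topspace_minimal_layer)

end

theorem theorem6p3:
  fixes V :: variety and G :: "'a pogroup" and F :: "'f pogroup" and \<eta> :: "'a \<Rightarrow> 'f"
  assumes "po_group G" and "free_over V G F \<eta>"
  shows "minimal_layer V G homeomorphic_space
    (case V of
       All \<Rightarrow> R_space (group_image G F \<eta>)
     | Representable \<Rightarrow> O_space (group_image G F \<eta>)
     | Abelian \<Rightarrow> O_space (group_image G F \<eta>))"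
proof -
  interpret free_extension G V F \<eta>
    using assms by (simp add: free_extension_def free_extension_axioms_def po_grpI)
  \<comment> \<open>For \<open>V = All\<close> the restriction is to the whole space of right orders
    and leaves the topology unchanged; otherwise it is the defining restriction of
    \<open>O_space\<close>.\<close>
  have "subtopology (R_space K) image_orders = (if V = All then R_space K else O_space K)"
    using subtopology_topspace[of "R_space K"] by (simp add: image_orders_eq O_space_def topspace_R_space)
  then show ?thesis
    using minimal_layer_homeomorphic by (cases V) simp_all
qed

end
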